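(* Let $T=T_s$ be a tent map with $s\in(\sqrt2,2]$, and assume that its critical point $c$ is preperiodic and such that $T^3(c)$ is not periodic. Embed the core $X'$ of its inverse limit in the plane by $\varphi_L$ with respect to an admissible left-infinite sequence $L=\ldots l_2l_1$ with $L\ne0^\infty l_n\ldots l_1$ for every $n\in\mathbb N$. A folding point $p\in X'$ is accessible if and only if the basic arc $A(\overleftarrow p)$ is the top or the bottom of a finite cylinder.
   Context: Tent inverse limits. For $s\in(\sqrt2,2]$ let $T=T_s\colon[0,1]\to[0,1]$, $T_s(t)=\min\{st,s(1-t)\}$, $c=\frac12$, and $X=\{x=(\pi_i(x))_{i\le0}\in[0,1]^{-\mathbb N_0}: T(\pi_i(x))=\pi_{i+1}(x)\ \forall i<0\}$ with the product topology. The core is $X'=\varprojlim([T^2(c),T(c)],T)\subset X$; $X=X'\cup\mathcal C$, where $\mathcal C$ is a ray containing the fixed point $(\ldots,0,0)$. A folding point of $X'$ is a point having no neighbourhood homeomorphic to (Cantor set)$\times(0,1)$. Symbolics. $\#_1(w)$ is the number of ones of a word $w$. The kneading sequence is $\nu=c_1c_2\ldots$, $c_i=0$ if $T^i(c)\in[0,c]$, $c_i=1$ if $T^i(c)\in[c,1]$; if $T^n(c)=c$, $\nu$ is the smaller of $(c_1\ldots c_{n-1}0)^\infty,(c_1\ldots c_{n-1}1)^\infty$ in the parity-lexicographical order: for sequences (or words of equal length) first differing at index $k$, $s\prec t$ iff $s_k<t_k$ and $\#_1(s_1\ldots s_{k-1})$ is even, or $s_k>t_k$ and it is odd. A word $a_1\ldots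 a_n$ is admissible if $c_2\ldots c_{2+n-i}\preceq a_i\ldots a_n\preceq c_1\ldots c_{1+n-i}$ for all $i$. An infinite sequence is admissible if all its finite subwords are; additionally, sequences $0^\infty s_ks_{k+1}\ldots$ with $s_k=1$ and the part from $s_k$ on admissible (and the constant zero sequence) are called admissible; these correspond to points of $\mathcal C$. $X$ is identified with $\Sigma_{adm}/\!\sim$, where $\Sigma_{adm}$ is the set of admissible two-sided sequences $\ldots s_{-1}.s_0s_1\ldots$ and $s\sim t$ iff $s=t$ or they differ at exactly one index $k$ and $s_{k+1}s_{k+2}\ldots=t_{k+1}t_{k+2}\ldots=\nu$; the point $x$ corresponds to the class of $(x_i)$ with $x_i=0$ (resp. $1$) if $\pi_i(x)$ (for $i\le0$) or $T^i(\pi_0(x))$ (for $i>0$) lies in $[0,c]$ (resp. $[c,1]$). Using only sequences all of whose finite subwords are admissible gives $X'$. Left-infinite sequences are written $\overleftarrow s=\ldots s_2s_1$ ($s_j$ being the entry at index $-j$), and the basic arc $A(\overleftarrow s)$ is the set of points of $X$ having a representative with left part $\overleftarrow s$; it is an arc or a point. In the preperiodic (non-periodic) case each folding point $p\in X'$ has a unique two-sided itinerary; $\overleftarrow p$ is its left part. Embeddings. For an admissible left-infinite $L=\ldots l_2l_1$, put $\overleftarrow s\prec_L\overleftarrow t$ iff, $k$ being the smallest index with $s_k\ne t_k$, either $t_k=l_k$ and $\#_1(s_{k-1}\ldots s_1)-\#_1(l_{k-1}\ldots l_1)$ is even, or $s_k=l_k$ and it is odd. Let $\psi_L(\overleftarrow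 s)=\sum_{i\ge1}(-1)^{\#_1(l_i\ldots l_1)-\#_1(s_i\ldots s_1)}3^{-i}+\frac12$. The embedding $\varphi_L\colon X\to\mathbb R^2$ draws each basic arc $A(\overleftarrow s)$ as the horizontal segment $\pi_0(A(\overleftarrow s))\times\{\psi_L(\overleftarrow s)\}$; whenever two $\sim$-identified two-sided sequences differ only at an index $k<0$, the corresponding endpoints of the two basic arcs are joined by a semicircle, on the left if $\#_1$ of the word at indices $k+1,\ldots,-1$ is odd and on the right if it is even. $X'$ is embedded by restricting $\varphi_L$. For an admissible word $a_n\ldots a_1$ the (finite) cylinder $[a_n\ldots a_1]$ is the set of admissible left-infinite sequences of $X'$ ending in $a_n\ldots a_1$; its top and bottom are its $\prec_L$-largest and $\prec_L$-smallest elements (identified with the corresponding basic arcs). A point $a$ of a plane continuum $K$ (here $K=\varphi_L(X')$) is accessible if some arc $A\subset\mathbb R^2$ has $A\cap K=\{a\}$. *)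

theory Defs
  imports "HOL-Analysis.Analysis"
begin

section \<open>Tent maps and their inverse limits\<close>

definition tent :: "real \<Rightarrow> real \<Rightarrow> real" where
  "tent s t = min (s * t) (s * (1 - t))"

definition crit :: real where
  "crit = 1 / 2"

definition periodic_pt :: "('a \<Rightarrow> 'a) \<Rightarrow> 'a \<Rightarrow> bool" where
  "periodic_pt f x \<longleftrightarrow> (\<exists>n>0. (f ^^ n) x = x)"

definition preperiodic_pt :: "('a \<Rightarrow> 'a) \<Rightarrow> 'a \<Rightarrow> bool" where
  "preperiodic_pt f x \<longleftrightarrow> \<not> periodic_pt f x \<and> (\<exists>m. periodic_pt f ((f ^^ m) x))"

text \<open>
  A point \<open>x\<close> of the inverse limit is written as a function on the naturals with
  \<open>x i\<close> standing for the coordinate \<open>\<pi>\<^sub>-\<^sub>i(x)\<close>. The topology of the function type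
  is the product topology.
\<close>

definition inv_lim :: "real set \<Rightarrow> (real \<Rightarrow> real) \<Rightarrow> (nat \<Rightarrow> real) set" where
  "inv_lim I f = {x. \<forall>i. x i \<in> I \<and> f (x (Suc i)) = x i}"

definition tent_lim :: "real \<Rightarrow> (nat \<Rightarrow> real) set" where
  "tent_lim s = inv_lim {0..1} (tent s)"

definition tent_core :: "real \<Rightarrow> (nat \<Rightarrow> real) set" where
  "tent_core s = inv_lim {(tent s ^^ 2) crit .. tent s crit} (tent s)"

definition cantor_set :: "real set" where
  "cantor_set = range (\<lambda>b :: nat \<Rightarrow> bool. \<Sum>n. 2 * of_bool (b n) / 3 ^ Suc n)"

definition folding_point :: "real \<Rightarrow> (nat \<Rightarrow> real) \<Rightarrow> bool" where
  "folding_point s p \<longleftrightarrow> p \<in> tent_core s \<and>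
     \<not> (\<exists>U N. openin (top_of_set (tent_core s)) U \<and> p \<in> U \<and> U \<subseteq> N \<and> N \<subseteq> tent_core s \<and>
          N homeomorphic (cantor_set \<times> {0<..<1::real}))"

section \<open>Symbolic dynamics\<close>

text \<open>The symbols 0 and 1 are \<^term>\<open>False\<close> and \<^term>\<open>True\<close> (so that \<open>False < True\<close>).\<close>

definition ones :: "bool list \<Rightarrow> nat" where
  "ones w = count_list w True"

definition plex_less :: "bool list \<Rightarrow> bool list \<Rightarrow> bool" where
  "plex_less u v \<longleftrightarrow> length u = length v \<and>
     (\<exists>k<length u. take k u = take k v \<and>
        (u ! k < v ! k \<and> even (ones (take k u)) \<or> v ! k < u ! k \<and> odd (ones (take k u))))"

definition plex_le :: "bool list \<Rightarrow> bool list \<Rightarrow> bool" where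
  "plex_le u v \<longleftrightarrow> u = v \<or> plex_less u v"

text \<open>
  The kneading sequence \<open>\<nu> = c\<^sub>1c\<^sub>2\<dots>\<close>, with \<open>knead s i\<close> standing for \<open>c\<^sub>i\<^sub>+\<^sub>1\<close>.
  It is only used when \<open>crit\<close> is not periodic, so that no iterate of \<open>crit\<close> equals \<open>crit\<close>
  and no symbol is ambiguous.
\<close>

definition knead :: "real \<Rightarrow> nat \<Rightarrow> bool" where
  "knead s i \<longleftrightarrow> (tent s ^^ Suc i) crit > crit"

definition adm_word :: "real \<Rightarrow> bool list \<Rightarrow> bool" where
  "adm_word s w \<longleftrightarrow> (\<forall>i<length w.
     plex_le (map (knead s) [1..<Suc (length w - i)]) (drop i w) \<and>
     plex_le (drop i w) (map (knead s) [0..<length w - i]))"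

text \<open>
  Left-infinite sequences \<open>\<dots>u\<^sub>2u\<^sub>1\<close> are functions \<open>u\<close> on the naturals with \<open>u j\<close> standing
  for the entry \<open>u\<^sub>j\<^sub>+\<^sub>1\<close> at index \<open>-(j+1)\<close>; thus \<open>rev (map u [m..<n])\<close> is the subword
  \<open>u\<^sub>n\<dots>u\<^sub>m\<^sub>+\<^sub>1\<close>.
\<close>

definition adm_left_core :: "real \<Rightarrow> (nat \<Rightarrow> bool) \<Rightarrow> bool" where
  "adm_left_core s u \<longleftrightarrow> (\<forall>m n. adm_word s (rev (map u [m..<n])))"

definition adm_left :: "real \<Rightarrow> (nat \<Rightarrow> bool) \<Rightarrow> bool" where
  "adm_left s u \<longleftrightarrow> adm_left_core s u \<or>
     (\<exists>k. u k \<and> (\<forall>j>k. \<not> u j) \<and> (\<forall>m n. n \<le> Suc k \<longrightarrow> adm_word s (rev (map u [m..<n])))) \<or>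
     (\<forall>j. \<not> u j)"

definition subword :: "(int \<Rightarrow> bool) \<Rightarrow> int \<Rightarrow> int \<Rightarrow> bool list" where
  "subword e a b = map e [a..b]"

definition Sigma_adm :: "real \<Rightarrow> (int \<Rightarrow> bool) set" where
  "Sigma_adm s = {e.
     (\<forall>a b. adm_word s (subword e a b)) \<or>
     (\<exists>k. e k \<and> (\<forall>j<k. \<not> e j) \<and> (\<forall>a b. k \<le> a \<longrightarrow> adm_word s (subword e a b))) \<or>
     (\<forall>j. \<not> e j)}"

definition left_part :: "(int \<Rightarrow> bool) \<Rightarrow> nat \<Rightarrow> bool" where
  "left_part e j = e (- int j - 1)"

text \<open>
  \<open>glued s k e e'\<close>: the distinct sequences \<open>e\<close> and \<open>e'\<close> are identified (represent the same point),
  and they differ exactly at the index \<open>k\<close>.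
\<close>

definition glued :: "real \<Rightarrow> int \<Rightarrow> (int \<Rightarrow> bool) \<Rightarrow> (int \<Rightarrow> bool) \<Rightarrow> bool" where
  "glued s k e e' \<longleftrightarrow> e \<in> Sigma_adm s \<and> e' \<in> Sigma_adm s \<and>
     e k \<noteq> e' k \<and> (\<forall>j. j \<noteq> k \<longrightarrow> e j = e' j) \<and> (\<forall>i. e (k + 1 + int i) = knead s i)"

text \<open>\<open>\<pi>\<^sub>i(x)\<close> for \<open>i \<le> 0\<close>, continued by \<open>T\<^sup>i(\<pi>\<^sub>0(x))\<close> for \<open>i > 0\<close>.\<close>

definition coord :: "real \<Rightarrow> (nat \<Rightarrow> real) \<Rightarrow> int \<Rightarrow> real" where
  "coord s x i = (if i \<le> 0 then x (nat (- i)) else (tent s ^^ nat i) (x 0))"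

definition itinerary :: "real \<Rightarrow> (nat \<Rightarrow> real) \<Rightarrow> (int \<Rightarrow> bool) \<Rightarrow> bool" where
  "itinerary s x e \<longleftrightarrow> e \<in> Sigma_adm s \<and>
     (\<forall>i. coord s x i \<in> (if e i then {crit..1} else {0..crit}))"

definition basic_arc :: "real \<Rightarrow> (nat \<Rightarrow> bool) \<Rightarrow> (nat \<Rightarrow> real) set" where
  "basic_arc s u = {x \<in> tent_lim s. \<exists>e. itinerary s x e \<and> left_part e = u}"

text \<open>Only meaningful for points with a unique itinerary.\<close>

definition left_itinerary :: "real \<Rightarrow> (nat \<Rightarrow> real) \<Rightarrow> nat \<Rightarrow> bool" where
  "left_itinerary s p = left_part (THE e. itinerary s p e)"

section \<open>The planar embeddings\<close>

text \<open>\<open>lones u n\<close> is the number of ones in \<open>u\<^sub>n\<dots>u\<^sub>1\<close>.\<close>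

definition lones :: "(nat \<Rightarrow> bool) \<Rightarrow> nat \<Rightarrow> nat" where
  "lones u n = ones (rev (map u [0..<n]))"

definition left_less :: "(nat \<Rightarrow> bool) \<Rightarrow> (nat \<Rightarrow> bool) \<Rightarrow> (nat \<Rightarrow> bool) \<Rightarrow> bool" where
  "left_less L u v \<longleftrightarrow> (\<exists>k. (\<forall>j<k. u j = v j) \<and> u k \<noteq> v k \<and>
     (v k = L k \<and> even (int (lones u k) - int (lones L k)) \<or>
      u k = L k \<and> odd (int (lones u k) - int (lones L k))))"

definition psi :: "(nat \<Rightarrow> bool) \<Rightarrow> (nat \<Rightarrow> bool) \<Rightarrow> real" where
  "psi L u = (\<Sum>i. (-1) powi (int (lones L (Suc i)) - int (lones u (Suc i))) / 3 ^ Suc i) + 1 / 2"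

text \<open>The semicircle with end points \<open>(a, y)\<close> and \<open>(a, z)\<close>, bulging to the left or to the right.\<close>

definition semicircle :: "bool \<Rightarrow> real \<Rightarrow> real \<Rightarrow> real \<Rightarrow> (real \<times> real) set" where
  "semicircle to_left a y z =
     {q \<in> sphere (a, (y + z) / 2) (\<bar>y - z\<bar> / 2). if to_left then fst q \<le> a else a \<le> fst q}"

text \<open>
  \<open>phi s L x\<close> is the part of the drawing that represents the point \<open>x\<close>. A point \<open>x\<close> of the
  basic arc of \<open>u\<close> is drawn at height \<open>psi L u\<close> above \<open>\<pi>\<^sub>0(x)\<close>, so each basic arc \<open>A(u)\<close> becomes the
  segment \<open>\<pi>\<^sub>0(A(u)) \<times> {psi L u}\<close>. A common end point of two basic arcs is drawn as the whole
  semicircle joining the corresponding end points of their segments; this is why \<open>phi\<close> is set-valued.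
  It is a singleton at every point with a unique itinerary. The embedding is the inverse of
  collapsing each semicircle to the point it represents, up to a reparametrisation near
  the common end points which does not change the image \<open>drawing s L\<close> of the core.
\<close>

definition phi :: "real \<Rightarrow> (nat \<Rightarrow> bool) \<Rightarrow> (nat \<Rightarrow> real) \<Rightarrow> (real \<times> real) set" where
  "phi s L x =
     {(x 0, psi L u) | u. x \<in> basic_arc s u} \<union>
     (\<Union>{semicircle (odd (ones (subword e (k + 1) (-1)))) (x 0) (psi L (left_part e)) (psi L (left_part e'))
        | e e' k. k < 0 \<and> glued s k e e' \<and> itinerary s x e \<and> itinerary s x e'})"

definition drawing :: "real \<Rightarrow> (nat \<Rightarrow> bool) \<Rightarrow> (real \<times> real) set" where
  "drawing s L = (\<Union>x\<in>tent_core s. phi s L x)"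

text \<open>
  The cylinder \<open>[w]\<close> of the word \<open>w = a\<^sub>n\<dots>a\<^sub>1\<close>, and its largest and smallest elements
  in the order \<open>left_less L\<close>.
\<close>

definition cylinder :: "real \<Rightarrow> bool list \<Rightarrow> (nat \<Rightarrow> bool) set" where
  "cylinder s w = {u. adm_left_core s u \<and> rev (map u [0..<length w]) = w}"

definition is_top :: "(nat \<Rightarrow> bool) \<Rightarrow> (nat \<Rightarrow> bool) set \<Rightarrow> (nat \<Rightarrow> bool) \<Rightarrow> bool" where
  "is_top L C u \<longleftrightarrow> u \<in> C \<and> (\<forall>v\<in>C. v = u \<or> left_less L v u)"

definition is_bottom :: "(nat \<Rightarrow> bool) \<Rightarrow> (nat \<Rightarrow> bool) set \<Rightarrow> (nat \<Rightarrow> bool) \<Rightarrow> bool" where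
  "is_bottom L C u \<longleftrightarrow> u \<in> C \<and> (\<forall>v\<in>C. v = u \<or> left_less L u v)"

definition accessible :: "(real \<times> real) set \<Rightarrow> real \<times> real \<Rightarrow> bool" where
  "accessible K a \<longleftrightarrow> a \<in> K \<and> (\<exists>g. arc g \<and> path_image g \<inter> K = {a})"

end

theory Submission
  imports Defs
begin

text \<open>
  Let \<open>P\<close> be the finite postcritical set. A point of the core with some coordinate outside \<open>P\<close> has
  a neighbourhood of the form interval times (perfect set of backward itineraries), so all
  coordinates of a folding point \<open>p\<close> lie in \<open>P\<close>, and being infinitely many they are periodic. As
  \<open>T\<^sup>3(c)\<close> is not periodic, no coordinate of \<open>p\<close> is one of \<open>c\<close>, \<open>T(c)\<close>, \<open>T\<^sup>2(c)\<close>, \<open>T\<^sup>3(c)\<close>.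

  Let \<open>u\<close> be the left itinerary of \<open>p\<close>. If \<open>u\<close> is the top or bottom of a cylinder, a short vertical
  segment at \<open>p\<close> meets no other basic arc. It meets no semicircle either: such a semicircle would
  join heights on both sides of that of \<open>u\<close>, hence \<open>u\<close> ends in the word \<open>c\<^sub>1\<dots>c\<^sub>j\<close> that determines
  the side on which the semicircle bulges; but then \<open>\<pi>\<^sub>-\<^sub>j(p) < T(c)\<close> puts \<open>\<pi>\<^sub>0(p)\<close> on the other side.

  If \<open>u\<close> is not extremal in any cylinder, then arbitrarily close to \<open>u\<close>, above and below, there are
  admissible sequences first differing from \<open>u\<close> at some index \<open>k\<close>. Replacing everything
  further left by ones keeps the order and yields a backward orbit that stays in the interior of the
  core and so avoids \<open>c\<close>. Its basic arc is a full segment over a fixed interval around \<open>\<pi>\<^sub>0(p)\<close>, and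
  such segments block every path to \<open>p\<close>.
\<close>

section \<open>Words and the parity-lexicographical order\<close>

lemma ones_Nil [simp]: "ones [] = 0"
  and ones_Cons [simp]: "ones (d # w) = of_bool d + ones w"
  by (auto simp: ones_def)

text \<open>A common leading 1 changes the parity of every longer prefix and so swaps the roles of
  the two tails. This recursion replaces the index \<open>k\<close> and suits induction along an
  orbit.\<close>

lemma plex_less_Cons:
  "plex_less (d # u) (d' # v) \<longleftrightarrow> length u = length v \<and>
     (if d = d' then (if d then plex_less v u else plex_less u v) else d < d')"
  by (cases d; cases d') (simp_all add: plex_less_def Ex_less_Suc2, auto)

lemma plex_le_Nil [simp]: "plex_le [] []"
  by (simp add: plex_le_def)

lemma plex_le_Cons:
  "length u = length v \<Longrightarrow> plex_le (d # u) (d' # v) \<longleftrightarrow>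
     (if d = d' then (if d then plex_le v u else plex_le u v) else d < d')"
  by (auto simp: plex_le_def plex_less_Cons)

lemma plex_le_antisym:
  "length u = length v \<Longrightarrow> plex_le u v \<Longrightarrow> plex_le v u \<Longrightarrow> u = v"
proof (induction u v rule: list_induct2)
  case (Cons x xs y ys)
  then show ?case by (auto simp: plex_le_Cons split: if_splits)
qed simp

lemma rev_left_part: "rev (map (left_part e) [0..<n]) = subword e (- int n) (-1)"
proof (induction n)
  case (Suc n)
  have "[-1 - int n..-1] = (- int n - 1) # [- int n..-1]" by (subst upto_rec1) auto
  then show ?case using Suc by (simp add: subword_def left_part_def)
qed (simp add: subword_def)

lemma rev_map_upt_eq_iff: "rev (map v [0..<n]) = rev (map u [0..<n]) \<longleftrightarrow> (\<forall>i<n. v i = u i)"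
  by (auto simp: map_eq_conv)

section \<open>Itineraries of points under the tent map\<close>

text \<open>At a visit to the critical point both symbols are allowed.\<close>

primrec follows :: "real \<Rightarrow> bool list \<Rightarrow> real \<Rightarrow> bool" where
  "follows s [] y = True"
| "follows s (d # w) y = (y \<in> (if d then {crit..1} else {0..crit}) \<and> follows s w (tent s y))"

lemma follows_iff:
  "follows s w y \<longleftrightarrow> (\<forall>i<length w. (tent s ^^ i) y \<in> (if w ! i then {crit..1} else {0..crit}))"
proof (induction w arbitrary: y)
  case (Cons d w)
  then show ?case
    by (simp add: All_less_Suc2 funpow_swap1 del: atLeastAtMost_iff)
qed simp

lemma tent_left: "0 < s \<Longrightarrow> t \<le> crit \<Longrightarrow> tent s t = s * t"
  and tent_right: "0 < s \<Longrightarrow> crit \<le> t \<Longrightarrow> tent s t = s * (1 - t)"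
  by (auto simp: tent_def crit_def min_def mult_le_cancel_left)

text \<open>Along a shared word both points always use the same affine branch, of slope
  \<open>s\<close> or \<open>-s\<close>, so their difference is multiplied by the product of these
  slopes.\<close>

lemma follows_diff:
  assumes "0 < s" "follows s w y" "follows s w z"
  shows "(tent s ^^ length w) z - (tent s ^^ length w) y = (-1) ^ ones w * s ^ length w * (z - y)"
  using assms(2,3)
proof (induction w arbitrary: y z)
  case (Cons d w)
  have "tent s z - tent s y = (-1) ^ of_bool d * s * (z - y)"
    using Cons.prems \<open>0 < s\<close> by (auto simp: tent_left tent_right algebra_simps split: if_splits)
  with Cons show ?case
    by (simp add: funpow_Suc_right power_add del: funpow.simps)
qed simp

text \<open>The tent map keeps strict order on the left half and reverses it on the right half, just
  as a symbol 1 reverses the order of the tails. The ambiguity at \<open>crit\<close> is harmless: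
  \<open>y < z\<close> excludes symbol 1 for \<open>y\<close> together with 0 for
  \<open>z\<close>.\<close>

lemma plex_le_of_less:
  assumes "0 < s" "length w = length w'" "y < z" "follows s w y" "follows s w' z"
  shows "plex_le w w'"
  using assms(2-)
proof (induction w arbitrary: w' y z rule: length_induct)
  case (1 w)
  show ?case
  proof (cases w)
    case Nil
    then show ?thesis using 1 by simp
  next
    case (Cons d u)
    then obtain d' u' where w': "w' = d' # u'" "length u = length u'"
      using 1 by (cases w') auto
    have IH: "plex_le u u'" if "tent s y < tent s z"
      using 1 that by (auto simp: Cons w')
    have IH': "plex_le u' u" if "tent s z < tent s y"
      using 1 that by (auto simp: Cons w')
    show ?thesis
      using 1(3-) IH IH' \<open>0 < s\<close>
      by (cases d; cases d') (auto simp: Cons w' plex_le_Cons tent_left tent_right)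
  qed
qed

lemma follows_unique:
  assumes "\<And>i. (tent s ^^ i) y \<noteq> crit" "length w = length w'" "follows s w y" "follows s w' y"
  shows "w = w'"
proof (rule nth_equalityI)
  fix i assume i: "i < length w"
  show "w ! i = w' ! i"
    using assms(1)[of i] assms(2-) i by (force simp: follows_iff split: if_splits)
qed (use assms in simp)

lemma follows_drop: "follows s w y \<Longrightarrow> follows s (drop i w) ((tent s ^^ i) y)"
  by (auto simp: follows_iff funpow_add[symmetric, THEN fun_cong, simplified comp_apply] add.commute)

section \<open>The height function\<close>

lemma lones_0 [simp]: "lones u 0 = 0"
  and lones_Suc [simp]: "lones u (Suc n) = of_bool (u n) + lones u n"
  by (auto simp: lones_def)

lemma lones_cong: "(\<And>j. j < n \<Longrightarrow> u j = v j) \<Longrightarrow> lones u n = lones v n"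
  by (induction n) auto

text \<open>The heights of basic arcs and the points of the Cantor set are both values of
  ternary series with digits \<open>\<plusminus>1\<close>.\<close>

definition ternary :: "(nat \<Rightarrow> real) \<Rightarrow> real" where
  "ternary a = (\<Sum>i. a i / 3 ^ Suc i)"

definition signs :: "(nat \<Rightarrow> real) \<Rightarrow> bool" where
  "signs a \<longleftrightarrow> (\<forall>i. a i = 1 \<or> a i = -1)"

lemma sums_third_tail: "(\<lambda>i. 2 / 3 ^ Suc (i + k)) sums (1 / 3 ^ k :: real)"
proof -
  have "(\<lambda>i. (2 / 3 ^ Suc k) * (1/3) ^ i) sums ((2 / 3 ^ Suc k) * (1 / (1 - 1 / 3)) :: real)"
    by (intro sums_mult geometric_sums) auto
  then show ?thesis by (simp add: power_add power_divide field_simps)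
qed

lemma ternary_summable:
  assumes "signs a"
  shows "summable (\<lambda>i. a i / 3 ^ Suc i)"
proof (rule summable_comparison_test'[of "\<lambda>i. 2 / 3 ^ Suc i" 0])
  show "summable (\<lambda>i. 2 / 3 ^ Suc i :: real)"
    using sums_third_tail[of 0] by (auto simp: sums_iff)
  fix n
  have "\<bar>a n\<bar> = 1" using assms by (auto simp: signs_def abs_if dest: spec[of _ n])
  then show "norm (a n / 3 ^ Suc n) \<le> 2 / 3 ^ Suc n" by (simp add: field_simps)
qed

lemma ternary_diff_tail:
  assumes "signs a" "signs b" "\<And>j. j < k \<Longrightarrow> a j = b j"
  shows "ternary b - ternary a = (\<Sum>i. (b (i + k) - a (i + k)) / 3 ^ Suc (i + k))"
    and "summable (\<lambda>i. (b (i + k) - a (i + k)) / 3 ^ Suc (i + k))"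
    and "\<bar>\<Sum>i. (b (i + k) - a (i + k)) / 3 ^ Suc (i + k)\<bar> \<le> 1 / 3 ^ k"
proof -
  let ?g = "\<lambda>i. (b i - a i) / 3 ^ Suc i" and ?f = "\<lambda>i. (b (i + k) - a (i + k)) / 3 ^ Suc (i + k)"
  have sm: "summable ?g"
    using summable_diff[OF ternary_summable[OF assms(2)] ternary_summable[OF assms(1)]]
    by (simp add: diff_divide_distrib)
  have "ternary b - ternary a = suminf ?g"
    using suminf_diff[OF ternary_summable[OF assms(2)] ternary_summable[OF assms(1)]]
    by (simp add: ternary_def diff_divide_distrib)
  also have "\<dots> = suminf ?f + sum ?g {..<k}"
    by (rule suminf_split_initial_segment[OF sm])
  also have "sum ?g {..<k} = 0"
    using assms(3) by (intro sum.neutral) auto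
  finally show "ternary b - ternary a = suminf ?f" by simp
  show "summable ?f" using sm by (subst summable_iff_shift)
  have "norm (suminf ?f) \<le> (\<Sum>i. 2 / 3 ^ Suc (i + k))"
  proof (rule norm_suminf_le)
    fix n
    have "\<bar>b (n + k) - a (n + k)\<bar> \<le> 2"
      using assms(1,2)[unfolded signs_def, rule_format, of "n + k"] by auto
    then show "norm (?f n) \<le> 2 / 3 ^ Suc (n + k)"
      by (simp add: divide_right_mono)
  qed (use sums_third_tail[of k] in \<open>auto simp: sums_iff\<close>)
  then show "\<bar>suminf ?f\<bar> \<le> 1 / 3 ^ k"
    using sums_third_tail[of k] by (simp add: sums_iff)
qed

lemma ternary_diff_le:
  assumes "signs a" "signs b" "\<And>j. j < k \<Longrightarrow> a j = b j"
  shows "\<bar>ternary b - ternary a\<bar> \<le> 1 / 3 ^ k"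
  using ternary_diff_tail[OF assms] by simp

text \<open>Different signs are opposite, so position \<open>k\<close> contributes exactly
  \<open>2 * b k / 3 ^ Suc k\<close>, and all later positions together at most half of that in
  absolute value. Hence the first difference decides the order and leaves a gap.\<close>

lemma ternary_diff_first:
  assumes "signs a" "signs b" "\<And>j. j < k \<Longrightarrow> a j = b j" "a k \<noteq> b k"
  shows "\<bar>ternary b - ternary a - 2 * b k / 3 ^ Suc k\<bar> \<le> 1 / 3 ^ Suc k"
proof -
  let ?f = "\<lambda>k i. (b (i + k) - a (i + k)) / 3 ^ Suc (i + k)"
  \<comment> \<open>\<open>c\<close> agrees with \<open>b\<close> one place further than
    \<open>a\<close> does and has the tail of \<open>a\<close> after \<open>k\<close>, so the tail
    bound applies with \<open>Suc k\<close>.\<close>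
  define c where "c i = (if i = k then b i else a i)" for i
  have c: "signs c" "\<And>j. j < Suc k \<Longrightarrow> c j = b j"
    using assms by (auto simp: signs_def c_def less_Suc_eq)
  have "a k = - b k"
    using assms(1,2)[unfolded signs_def, rule_format, of k] assms(4) by auto
  moreover have "suminf (?f k) = ?f k 0 + suminf (?f (Suc k))"
    using suminf_split_head[OF ternary_diff_tail(2)[OF assms(1-3)]] by simp
  ultimately have "ternary b - ternary a - 2 * b k / 3 ^ Suc k = suminf (?f (Suc k))"
    using ternary_diff_tail(1)[OF assms(1-3)] by simp
  moreover have "suminf (?f (Suc k)) = (\<Sum>i. (b (i + Suc k) - c (i + Suc k)) / 3 ^ Suc (i + Suc k))"
    by (simp add: c_def)
  ultimately show ?thesis
    using ternary_diff_tail(3)[OF c(1) assms(2), of "Suc k"] c(2) by simp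
qed

section \<open>Heights of basic arcs and the order of left-infinite sequences\<close>

definition psi_sign :: "(nat \<Rightarrow> bool) \<Rightarrow> (nat \<Rightarrow> bool) \<Rightarrow> nat \<Rightarrow> real" where
  "psi_sign L u i = (-1) ^ (lones L (Suc i) + lones u (Suc i))"

lemma minus_one_powi_diff: "(-1 :: real) powi (int m - int n) = (-1) ^ (m + n)"
proof (cases "n \<le> m")
  case True
  then show ?thesis by (simp flip: of_nat_diff add: minus_one_power_iff)
next
  case False
  then have "(-1 :: real) powi (int m - int n) = inverse ((-1) powi int (n - m))"
    by (simp flip: power_int_minus add: of_nat_diff)
  then show ?thesis using False by (simp add: minus_one_power_iff)
qed

lemma psi_eq: "psi L u = ternary (psi_sign L u) + 1 / 2"
  unfolding psi_def psi_sign_def ternary_def minus_one_powi_diff ..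

lemma psi_sign_cases: "psi_sign L u i = 1 \<or> psi_sign L u i = -1"
  by (auto simp: psi_sign_def minus_one_power_iff)

lemma signs_psi_sign: "signs (psi_sign L u)"
  by (simp add: signs_def psi_sign_cases)

lemma psi_sign_cong: "(\<And>j. j \<le> i \<Longrightarrow> u j = v j) \<Longrightarrow> psi_sign L u i = psi_sign L v i"
  unfolding psi_sign_def by (subst lones_cong[of "Suc i" u v]) auto

lemma psi_diff_le:
  assumes "\<And>j. j < k \<Longrightarrow> u j = v j"
  shows "\<bar>psi L v - psi L u\<bar> \<le> 1 / 3 ^ k"
proof -
  have "\<And>j. j < k \<Longrightarrow> psi_sign L u j = psi_sign L v j" using assms by (intro psi_sign_cong) auto
  then show ?thesis using ternary_diff_le[OF signs_psi_sign signs_psi_sign] by (simp add: psi_eq)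
qed

lemma psi_diff_first:
  assumes "\<And>j. j < k \<Longrightarrow> u j = v j" "u k \<noteq> v k"
  shows "\<bar>psi L v - psi L u - 2 * psi_sign L v k / 3 ^ Suc k\<bar> \<le> 1 / 3 ^ Suc k"
proof -
  have "\<And>j. j < k \<Longrightarrow> psi_sign L u j = psi_sign L v j" using assms by (intro psi_sign_cong) auto
  moreover have "lones u k = lones v k" using assms by (intro lones_cong) auto
  then have "psi_sign L u k \<noteq> psi_sign L v k"
    using assms(2) by (auto simp: psi_sign_def minus_one_power_iff)
  ultimately show ?thesis
    using ternary_diff_first[OF signs_psi_sign signs_psi_sign] by (simp add: psi_eq)
qed

lemma first_difference:
  fixes u v :: "nat \<Rightarrow> bool"
  assumes "u \<noteq> v"
  obtains k where "\<And>j. j < k \<Longrightarrow> u j = v j" "u k \<noteq> v k"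
  using assms exists_least_iff[of "\<lambda>k. u k \<noteq> v k"] by fastforce

lemma psi_diff_ge:
  assumes "k < n" "u k \<noteq> v k"
  shows "1 / 3 ^ n \<le> \<bar>psi L v - psi L u\<bar>"
proof -
  obtain j where j: "\<And>i. i < j \<Longrightarrow> u i = v i" "u j \<noteq> v j"
    using assms(2) first_difference by metis
  then have "Suc j \<le> n" using assms by (metis Suc_leI leI order.strict_trans1)
  then have "1 / 3 ^ n \<le> (1 / 3 ^ Suc j :: real)" by (intro divide_left_mono power_increasing) auto
  moreover have "\<bar>psi L v - psi L u - 2 * psi_sign L v j / 3 ^ Suc j\<bar> \<le> 1 / 3 ^ Suc j"
    using psi_diff_first j by blast
  ultimately show ?thesis using psi_sign_cases[of L v j] by (auto simp: abs_if split: if_splits)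
qed

text \<open>The counts of ones before the first difference agree, so the sign of \<open>v\<close>
  there encodes both the parity and which of \<open>u\<close> and \<open>v\<close> agrees with
  \<open>L\<close>. The same sign decides the order of the heights.\<close>

lemma left_less_iff_psi:
  assumes "\<And>j. j < k \<Longrightarrow> u j = v j" "u k \<noteq> v k"
  shows "left_less L u v \<longleftrightarrow> psi_sign L v k = 1"
    and "psi L u < psi L v \<longleftrightarrow> psi_sign L v k = 1"
proof -
  have l: "lones u k = lones v k" using assms by (intro lones_cong) auto
  have "left_less L u v \<longleftrightarrow> (v k = L k \<and> even (lones u k + lones L k) \<or>
      u k = L k \<and> odd (lones u k + lones L k))"
  proof -
    let ?C = "\<lambda>k. v k = L k \<and> even (int (lones u k) - int (lones L k)) \<or>
        u k = L k \<and> odd (int (lones u k) - int (lones L k))"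
    have "j = k" if "\<forall>i<j. u i = v i" "u j \<noteq> v j" for j
      using assms that by (metis linorder_neqE_nat)
    then have "(\<exists>j. (\<forall>i<j. u i = v i) \<and> u j \<noteq> v j \<and> ?C j) \<Longrightarrow> ?C k"
      by blast
    moreover have "?C k \<Longrightarrow> \<exists>j. (\<forall>i<j. u i = v i) \<and> u j \<noteq> v j \<and> ?C j"
      using assms by blast
    ultimately have "left_less L u v \<longleftrightarrow> ?C k"
      unfolding left_less_def by blast
    then show ?thesis by simp
  qed
  then show "left_less L u v \<longleftrightarrow> psi_sign L v k = 1"
    using l assms(2) by (auto simp: psi_sign_def minus_one_power_iff)
  have "\<bar>psi L v - psi L u - 2 * psi_sign L v k / 3 ^ Suc k\<bar> \<le> 1 / 3 ^ Suc k"
    using psi_diff_first assms by blast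
  then show "psi L u < psi L v \<longleftrightarrow> psi_sign L v k = 1"
    using psi_sign_cases[of L v k] zero_less_power[of "3::real" "Suc k"]
    by (auto simp: abs_if simp del: power_Suc zero_less_power split: if_splits)
      (smt (verit) divide_pos_pos)+
qed

lemma left_less_iff: "left_less L u v \<longleftrightarrow> psi L u < psi L v"
proof (cases "u = v")
  case True
  then show ?thesis by (auto simp: left_less_def)
next
  case False
  then show ?thesis using first_difference left_less_iff_psi by metis
qed

text \<open>The first difference already decides the order, so the tail of \<open>v\<close> beyond
  \<open>k\<close> may be replaced at will, later by ones.\<close>

lemma psi_less_cong:
  assumes "\<And>j. j < k \<Longrightarrow> u j = v j" "u k \<noteq> v k" "\<And>j. j \<le> k \<Longrightarrow> w j = v j"
  shows "psi L u < psi L v \<longleftrightarrow> psi L u < psi L w"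
  using left_less_iff_psi(2)[of k u v L] left_less_iff_psi(2)[of k u w L] psi_sign_cong[of k w v L]
    assms by simp

lemma psi_inj: "psi L u = psi L v \<Longrightarrow> u = v"
proof (rule ccontr)
  assume "psi L u = psi L v" "u \<noteq> v"
  then obtain k where "u k \<noteq> v k" by auto
  then have "1 / 3 ^ Suc k \<le> \<bar>psi L v - psi L u\<bar>" using psi_diff_ge[of k "Suc k" u v L] by auto
  moreover have "0 < (1 / 3 ^ Suc k :: real)" by simp
  ultimately show False using \<open>psi L u = psi L v\<close> by linarith
qed

section \<open>Perfect sets of binary sequences\<close>

lemma open_prefix: "open {v :: nat \<Rightarrow> bool. \<forall>m<n. v m = u m}"
proof -
  have "{v :: nat \<Rightarrow> bool. \<forall>m<n. v m = u m} = (\<Inter>m\<in>{..<n}. (\<lambda>v. v m) -` {u m})" by auto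
  then show ?thesis
    by (auto intro!: open_INT open_vimage continuous_on_product_coordinates open_discrete)
qed

lemma continuous_on_prefix:
  fixes f :: "(nat \<Rightarrow> bool) \<Rightarrow> 'a :: metric_space"
  assumes "\<And>u e. u \<in> K \<Longrightarrow> 0 < e \<Longrightarrow> \<exists>n. \<forall>v\<in>K. (\<forall>m<n. v m = u m) \<longrightarrow> dist (f v) (f u) < e"
  shows "continuous_on K f"
  unfolding continuous_on_def
proof (intro ballI tendstoI)
  fix u e assume "u \<in> K" "(0::real) < e"
  then obtain n where "\<forall>v\<in>K. (\<forall>m<n. v m = u m) \<longrightarrow> dist (f v) (f u) < e" using assms by blast
  then show "eventually (\<lambda>v. dist (f v) (f u) < e) (at u within K)"
    unfolding eventually_at_topological
    by (intro exI[of _ "{v. \<forall>m<n. v m = u m}"]) (auto simp: open_prefix)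
qed

lemma compact_binary_sequences: "compact (UNIV :: (nat \<Rightarrow> bool) set)"
proof -
  have "compact_space (product_topology (\<lambda>_. euclidean :: bool topology) (UNIV :: nat set))"
    by (subst compact_space_product_topology) (simp add: compact_space_def finite_imp_compact)
  then show ?thesis
    unfolding euclidean_product_topology by (simp add: compact_space_def)
qed

definition cantor_point :: "(nat \<Rightarrow> bool) \<Rightarrow> real" where
  "cantor_point b = ternary (\<lambda>i. if b i then 1 else -1) + 1 / 2"

text \<open>Since 1/2 is the sum of all \<open>1 / 3 ^ Suc i\<close>, adding it shifts the digits -1
  and 1 to the usual 0 and 2.\<close>

lemma range_cantor_point: "range cantor_point = cantor_set"
proof -
  have "cantor_point b = (\<Sum>n. 2 * of_bool (b n) / 3 ^ Suc n)" for b
  proof -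
    have "signs (\<lambda>i. if b i then 1 else -1)" by (simp add: signs_def)
    then have "(\<lambda>i. (if b i then 1 else -1) / 3 ^ Suc i) sums ternary (\<lambda>i. if b i then 1 else -1)"
      unfolding ternary_def by (rule summable_sums[OF ternary_summable])
    moreover have "(\<lambda>i. 1 / 3 ^ Suc i :: real) sums (1 / 2)"
      using sums_mult[OF sums_third_tail[of 0], of "1 / 2"] by simp
    ultimately have "(\<lambda>i. (if b i then 1 else -1) / 3 ^ Suc i + 1 / 3 ^ Suc i) sums cantor_point b"
      unfolding cantor_point_def by (rule sums_add)
    moreover have "(if b i then 1 else -1) / 3 ^ Suc i + 1 / 3 ^ Suc i = (2 * of_bool (b i) / 3 ^ Suc i :: real)" for i
      by simp
    ultimately show ?thesis by (simp add: sums_iff)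
  qed
  then show ?thesis by (simp add: cantor_set_def)
qed

lemma cantor_point_close:
  assumes "\<And>j. j < k \<Longrightarrow> a j = b j"
  shows "dist (cantor_point a) (cantor_point b) \<le> 1 / 3 ^ k"
  using ternary_diff_le[of "\<lambda>i. if b i then 1 else -1" "\<lambda>i. if a i then 1 else -1" k] assms
  by (simp add: cantor_point_def dist_real_def signs_def)

lemma inj_cantor_point: "inj cantor_point"
proof (rule injI, rule ccontr)
  fix a b assume eq: "cantor_point a = cantor_point b" and "a \<noteq> b"
  then obtain k where k: "\<And>j. j < k \<Longrightarrow> a j = b j" "a k \<noteq> b k"
    using first_difference by metis
  have "\<bar>- 2 * (if b k then 1 else -1) / 3 ^ Suc k\<bar> \<le> (1 / 3 ^ Suc k :: real)"
    using ternary_diff_first[of "\<lambda>i. if a i then 1 else -1" "\<lambda>i. if b i then 1 else -1" k] k eq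
    by (simp add: cantor_point_def signs_def)
  then show False by (auto split: if_splits simp: field_simps)
qed

text \<open>Reading a member of a perfect set only at the indices where the set branches off
  gives an arbitrary binary sequence.\<close>

definition branching :: "(nat \<Rightarrow> bool) set \<Rightarrow> (nat \<Rightarrow> bool) \<Rightarrow> nat set" where
  "branching K u = {n. \<exists>v\<in>K. (\<forall>m<n. v m = u m) \<and> v n \<noteq> u n}"

definition branch_code :: "(nat \<Rightarrow> bool) set \<Rightarrow> (nat \<Rightarrow> bool) \<Rightarrow> nat \<Rightarrow> bool" where
  "branch_code K u i = u (enumerate (branching K u) i)"

lemma enumerate_cong:
  assumes "infinite A" "infinite B" "\<And>m. m \<le> n \<Longrightarrow> m \<in> A \<longleftrightarrow> m \<in> B" "enumerate A i \<le> (n::nat)"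
  shows "enumerate B i = enumerate A i"
  using assms(4)
proof (induction i)
  case 0
  have "enumerate A 0 \<in> A" using assms(1) by (rule enumerate_in_set)
  then show ?case
    unfolding enumerate.simps using 0 assms(3)
    by (intro Least_equality) (auto simp: enumerate_0 intro: Least_le, metis Least_le enumerate_0 le_cases order_trans)
next
  case (Suc i)
  have "enumerate A i < enumerate A (Suc i)" using assms(1) by (rule enumerate_step)
  then have IH: "enumerate B i = enumerate A i" using Suc by simp
  let ?q = "enumerate A (Suc i)"
  have q: "?q \<in> A" "?q = (LEAST s. s \<in> A \<and> enumerate A i < s)"
    using assms(1) by (auto intro: enumerate_in_set enumerate_Suc'')
  have "enumerate B (Suc i) = (LEAST s. s \<in> B \<and> enumerate A i < s)"
    using assms(2) enumerate_Suc''[of B i] IH by simp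
  also have "\<dots> = ?q"
  proof (rule Least_equality)
    show "?q \<in> B \<and> enumerate A i < ?q"
      using q(1) assms(3) Suc.prems \<open>enumerate A i < ?q\<close> by simp
    fix y assume y: "y \<in> B \<and> enumerate A i < y"
    show "?q \<le> y"
    proof (cases "y \<le> n")
      case True
      then show ?thesis using y assms(3) unfolding q(2) by (intro Least_le) simp
    qed (use Suc.prems in simp)
  qed
  finally show ?case .
qed

context
  fixes K :: "(nat \<Rightarrow> bool) set"
  assumes perfect: "\<And>u n. u \<in> K \<Longrightarrow> \<exists>v\<in>K. (\<forall>m<n. v m = u m) \<and> v \<noteq> u"
begin

lemma infinite_branching: "u \<in> K \<Longrightarrow> infinite (branching K u)"
  unfolding infinite_nat_iff_unbounded_le
proof
  fix n assume "u \<in> K"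
  then obtain v where v: "v \<in> K" "\<forall>m<n. v m = u m" "v \<noteq> u" using perfect by blast
  then obtain k where k: "\<And>j. j < k \<Longrightarrow> v j = u j" "v k \<noteq> u k" using first_difference by metis
  then have "n \<le> k" using v(2) by (meson not_le)
  then show "\<exists>k\<ge>n. k \<in> branching K u" using k v(1) by (auto simp: branching_def)
qed

text \<open>The index \<open>n\<close> itself is included: if \<open>v\<close> leaves
  \<open>u\<close> at \<open>m\<close>, then \<open>u\<close> witnesses that \<open>K\<close>
  branches off \<open>v\<close> there.\<close>

lemma branching_agree:
  assumes "u \<in> K" "\<forall>m<n. v m = u m" "m \<le> n" "m \<in> branching K u"
  shows "m \<in> branching K v"
proof -
  obtain w where w: "w \<in> K" "\<forall>j<m. w j = u j" "w m \<noteq> u m"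
    using assms(4) unfolding branching_def by blast
  have uv: "v j = u j" if "j < m" for j using assms(2,3) that by simp
  show ?thesis
  proof (cases "v m = u m")
    case True
    have "\<forall>j<m. w j = v j" using w(2) uv by metis
    moreover have "w m \<noteq> v m" using w(3) True by metis
    ultimately show ?thesis unfolding branching_def using w(1) by blast
  next
    case False
    have "\<forall>j<m. u j = v j" using uv by metis
    moreover have "u m \<noteq> v m" using False by metis
    ultimately show ?thesis unfolding branching_def using assms(1) by blast
  qed
qed

lemma enumerate_branching_agree:
  assumes "u \<in> K" "v \<in> K" "\<forall>m<n. v m = u m" "enumerate (branching K u) i \<le> n"
  shows "enumerate (branching K v) i = enumerate (branching K u) i"
proof (rule enumerate_cong[OF infinite_branching[OF assms(1)] infinite_branching[OF assms(2)] _ assms(4)])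
  have "\<forall>m<n. u m = v m" using assms(3) by metis
  then show "m \<in> branching K u \<longleftrightarrow> m \<in> branching K v" if "m \<le> n" for m
    using branching_agree[OF assms(1,3) that] branching_agree[OF assms(2) _ that] by blast
qed

text \<open>Digits are corrected one at a time: a member of \<open>K\<close> that leaves
  \<open>u\<close> exactly at the branching index of rank \<open>i\<close> has the other digit there
  and keeps the earlier ones.\<close>

lemma branch_code_dense: "K \<noteq> {} \<Longrightarrow> \<exists>u\<in>K. \<forall>j<i. branch_code K u j = b j"
proof (induction i)
  case (Suc i)
  then obtain u where u: "u \<in> K" "\<forall>j<i. branch_code K u j = b j" by blast
  let ?n = "enumerate (branching K u) i"
  have "?n \<in> branching K u" using infinite_branching[OF u(1)] by (rule enumerate_in_set)
  then obtain v where v: "v \<in> K" "\<forall>m<?n. v m = u m" "v ?n \<noteq> u ?n" by (auto simp: branching_def)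
  have le: "enumerate (branching K u) j \<le> ?n" if "j \<le> i" for j
    using that infinite_branching[OF u(1)] by (metis enumerate_mono le_less less_imp_le)
  have eq: "enumerate (branching K v) j = enumerate (branching K u) j" if "j \<le> i" for j
    using enumerate_branching_agree[OF u(1) v(1,2) le[OF that]] .
  have "branch_code K v j = branch_code K u j" if "j < i" for j
    using eq[of j] that v(2) enumerate_mono[OF that infinite_branching[OF u(1)]]
    by (simp add: branch_code_def)
  moreover have "branch_code K v i \<noteq> branch_code K u i"
    using eq[of i] v(3) by (simp add: branch_code_def)
  ultimately have "(\<forall>j<Suc i. branch_code K u j = b j) \<or> (\<forall>j<Suc i. branch_code K v j = b j)"
    using u(2) by (auto simp: less_Suc_eq)
  then show ?case using u(1) v(1) by blast
qed auto

text \<open>A continuous injection of a compact set is a homeomorphism onto its image. The image is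
  the whole Cantor set because it is closed and, every finite code being realised, dense.\<close>

lemma perfect_homeomorphic_cantor:
  assumes "closed K" "K \<noteq> {}"
  shows "K homeomorphic cantor_set"
proof -
  let ?h = "\<lambda>u. cantor_point (branch_code K u)"
  have compact: "compact K"
    using compact_Int_closed[OF compact_binary_sequences assms(1)] by simp
  have cont: "continuous_on K ?h"
  proof (rule continuous_on_prefix)
    fix u and e :: real assume u: "u \<in> K" and "0 < e"
    then obtain k where k: "(1 / 3) ^ k < e" using real_arch_pow_inv[of e "1 / 3"] by auto
    let ?n = "Suc (enumerate (branching K u) k)"
    have "dist (?h v) (?h u) < e" if v: "v \<in> K" "\<forall>m<?n. v m = u m" for v
    proof -
      have "branch_code K v j = branch_code K u j" if "j < k" for j
      proof -
        have "enumerate (branching K u) j < ?n"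
          using enumerate_mono[OF that infinite_branching[OF u]] by simp
        then show ?thesis
          using enumerate_branching_agree[OF u v, of j] v(2) by (simp add: branch_code_def)
      qed
      then have "dist (?h v) (?h u) \<le> 1 / 3 ^ k" by (rule cantor_point_close)
      then show ?thesis using k by (simp add: power_divide)
    qed
    then show "\<exists>n. \<forall>v\<in>K. (\<forall>m<n. v m = u m) \<longrightarrow> dist (?h v) (?h u) < e" by blast
  qed
  have "inj_on ?h K"
  proof (rule inj_onI, rule ccontr)
    \<comment> \<open>The first difference of two members is a branching index of both, of the same
      rank, and hence visible in the codes.\<close>
    fix u v assume uv: "u \<in> K" "v \<in> K" "?h u = ?h v" "u \<noteq> v"
    then obtain n where n: "\<And>m. m < n \<Longrightarrow> v m = u m" "v n \<noteq> u n" using first_difference by metis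
    then have "n \<in> branching K u" using uv(2) by (auto simp: branching_def)
    then obtain i where i: "enumerate (branching K u) i = n"
      using enumerate_Ex[OF infinite_branching[OF uv(1)]] by metis
    then have "enumerate (branching K v) i = n"
      using enumerate_branching_agree[OF uv(1,2), of n i] n(1) by simp
    then have "branch_code K u i \<noteq> branch_code K v i" using i n(2) by (simp add: branch_code_def)
    then show False using uv(3) inj_cantor_point by (metis injD)
  qed
  moreover have "?h ` K = cantor_set"
  proof
    show "?h ` K \<subseteq> cantor_set" using range_cantor_point by auto
    have "closed (?h ` K)" using compact_continuous_image[OF cont compact] by (rule compact_imp_closed)
    moreover have "cantor_point b \<in> closure (?h ` K)" for b
      unfolding closure_approachable
    proof (intro allI impI)
      fix e :: real assume "0 < e"
      then obtain k where k: "(1 / 3) ^ k < e" using real_arch_pow_inv[of e "1 / 3"] by auto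
      obtain u where "u \<in> K" "\<forall>j<k. branch_code K u j = b j" using branch_code_dense[OF assms(2)] by blast
      then show "\<exists>y\<in>?h ` K. dist y (cantor_point b) < e"
        using cantor_point_close[of k "branch_code K u" b] k
        by (intro bexI[of _ "?h u"]) (auto simp: power_divide)
    qed
    ultimately show "cantor_set \<subseteq> ?h ` K" using range_cantor_point by (metis closure_closed image_subset_iff)
  qed
  ultimately show ?thesis using homeomorphic_compact[OF compact cont] by blast
qed

end

section \<open>Product neighbourhoods and continuity of symbols\<close>

lemma homeomorphic_Times_swap:
  assumes "A homeomorphic A'" "B homeomorphic B'"
  shows "(A \<times> B) homeomorphic (B' \<times> A')"
proof -
  obtain f f' where f: "\<And>x. x \<in> A \<Longrightarrow> f x \<in> A' \<and> f' (f x) = x" "\<And>y. y \<in> A' \<Longrightarrow> f' y \<in> A \<and> f (f' y) = y"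
    "continuous_on A f" "continuous_on A' f'"
    using assms(1) unfolding homeomorphic_minimal by metis
  obtain g g' where g: "\<And>x. x \<in> B \<Longrightarrow> g x \<in> B' \<and> g' (g x) = x" "\<And>y. y \<in> B' \<Longrightarrow> g' y \<in> B \<and> g (g' y) = y"
    "continuous_on B g" "continuous_on B' g'"
    using assms(2) unfolding homeomorphic_minimal by metis
  have "continuous_on (A \<times> B) (\<lambda>z. (g (snd z), f (fst z)))"
    by (intro continuous_on_Pair continuous_on_compose2[OF g(3)] continuous_on_compose2[OF f(3)]
        continuous_on_fst continuous_on_snd continuous_on_id) auto
  moreover have "continuous_on (B' \<times> A') (\<lambda>z. (f' (snd z), g' (fst z)))"
    by (intro continuous_on_Pair continuous_on_compose2[OF g(4)] continuous_on_compose2[OF f(4)]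
        continuous_on_fst continuous_on_snd continuous_on_id) auto
  ultimately show ?thesis
    unfolding homeomorphic_minimal using f(1,2) g(1,2)
    by (intro exI[of _ "\<lambda>z. (g (snd z), f (fst z))"] exI[of _ "\<lambda>z. (f' (snd z), g' (fst z))"]) simp
qed

lemma homeomorphic_open_interval_unit:
  fixes c d :: real
  assumes "0 < d"
  shows "{c - d<..<c + d} homeomorphic {0<..<1::real}"
proof (rule homeomorphicI)
  let ?f = "\<lambda>t. (t - (c - d)) / (2 * d)" and ?g = "\<lambda>u. c - d + 2 * d * u"
  have f: "?f t \<in> {0<..<1}" if "t \<in> {c - d<..<c + d}" for t
    using that assms by (auto simp: field_simps)
  have g: "?g u \<in> {c - d<..<c + d}" if "u \<in> {0<..<1}" for u
  proof -
    have "0 < 2 * d * u" "2 * d * u < 2 * d * 1" using that assms by (auto intro: mult_strict_left_mono)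
    then show ?thesis by auto
  qed
  have fg: "?f (?g u) = u" for u using assms by simp
  have gf: "?g (?f t) = t" for t using assms by simp
  show "?f ` {c - d<..<c + d} = {0<..<1}"
    using f g fg by (metis (no_types, lifting) image_eqI image_subsetI subsetI subset_antisym)
  show "?g ` {0<..<1} = {c - d<..<c + d}"
    using f g gf by (metis (no_types, lifting) image_eqI image_subsetI subsetI subset_antisym)
  show "?g (?f t) = t" for t by (rule gf)
  show "?f (?g u) = u" for u by (rule fg)
qed (use assms in \<open>auto intro!: continuous_intros\<close>)

text \<open>A continuous function avoiding \<open>c\<close> stays locally on one side of it. For
  \<open>c = crit\<close> this makes the symbols of a point depend continuously on the
  point.\<close>

lemma continuous_on_greater_const:
  fixes f :: "'a :: topological_space \<Rightarrow> real"
  assumes "continuous_on U f" "\<And>x. x \<in> U \<Longrightarrow> f x \<noteq> c"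
  shows "continuous_on U (\<lambda>x. f x > c)"
  unfolding continuous_on_def
proof
  fix x assume x: "x \<in> U"
  then have lim: "(f \<longlongrightarrow> f x) (at x within U)" using assms(1) by (auto simp: continuous_on_def)
  have "f x < c \<or> c < f x" using assms(2)[OF x] by auto
  then have "eventually (\<lambda>y. (f y > c) = (f x > c)) (at x within U)"
    using order_tendstoD[OF lim, of c] by (auto elim!: eventually_mono)
  then show "((\<lambda>y. f y > c) \<longlongrightarrow> (f x > c)) (at x within U)" by (rule tendsto_eventually)
qed

section \<open>The core of a tent map with preperiodic critical point\<close>

text \<open>The two inverse branches of the tent map; \<open>pullback\<close> is the backward orbit
  of \<open>t\<close> that chooses between them by \<open>v\<close>.\<close>

definition branch :: "real \<Rightarrow> bool \<Rightarrow> real \<Rightarrow> real" where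
  "branch s d y = (if d then 1 - y / s else y / s)"

primrec pullback :: "real \<Rightarrow> (nat \<Rightarrow> bool) \<Rightarrow> real \<Rightarrow> nat \<Rightarrow> real" where
  "pullback s v t 0 = t"
| "pullback s v t (Suc i) = branch s (v i) (pullback s v t i)"

lemma continuous_on_pullback: "continuous_on A (\<lambda>t. pullback s v t i)"
proof (induction i)
  case (Suc i)
  show ?case
    by (cases "v i") (simp_all add: branch_def divide_inverse continuous_intros Suc)
qed simp

lemma pullback_cong: "(\<And>j. j < i \<Longrightarrow> v j = w j) \<Longrightarrow> pullback s v t i = pullback s w t i"
  by (induction i) auto

lemma funpow_tent_nested: "(tent s ^^ i) ((tent s ^^ j) y) = (tent s ^^ (i + j)) y"
  by (simp add: funpow_add)

lemma periodic_pt_funpow: "periodic_pt f x \<Longrightarrow> periodic_pt f ((f ^^ n) x)"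
  unfolding periodic_pt_def by (metis comp_apply funpow_add add.commute)

text \<open>Only the coordinates with a negative index are constrained, so that \<open>x 0\<close>
  can vary along a basic arc.\<close>

definition left_compat :: "(nat \<Rightarrow> bool) \<Rightarrow> (nat \<Rightarrow> real) \<Rightarrow> bool" where
  "left_compat v x \<longleftrightarrow> (\<forall>i. x (Suc i) \<in> (if v i then {crit..1} else {0..crit}))"

locale preperiodic_tent =
  fixes s :: real
  assumes slope: "sqrt 2 < s" "s \<le> 2"
    and crit_preperiodic: "preperiodic_pt (tent s) crit"
    and T3_not_periodic: "\<not> periodic_pt (tent s) ((tent s ^^ 3) crit)"
begin

abbreviation "T \<equiv> tent s"
abbreviation "lo \<equiv> (T ^^ 2) crit"
abbreviation "hi \<equiv> T crit"

section \<open>The core interval and the critical orbit\<close>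

definition postcrit :: "real set" where
  "postcrit = {(T ^^ n) crit | n. 1 \<le> n}"

lemma s_gt: "2 < s * s" "1 < s"
proof -
  show "2 < s * s"
    using mult_strict_mono[OF slope(1) slope(1)] slope(1) real_sqrt_ge_zero[of 2] by simp
  show "1 < s" using slope(1) real_sqrt_gt_1_iff[of 2] by linarith
qed

lemma s_pos: "0 < s" using s_gt by simp

lemma hi_eq: "hi = s / 2"
  by (simp add: tent_def crit_def)

lemma lo_eq: "lo = s * (1 - s / 2)"
  using s_gt by (simp add: numeral_2_eq_2 hi_eq tent_right crit_def)

lemma lo_hi: "0 \<le> lo" "lo < crit" "crit < hi" "hi \<le> 1"
proof -
  show "0 \<le> lo" "crit < hi" "hi \<le> 1" using s_gt slope unfolding lo_eq hi_eq by (auto simp: crit_def)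
  have "0 < (s - 1) * (s - 1)" using s_gt by simp
  then show "lo < crit" unfolding lo_eq by (simp add: crit_def algebra_simps)
qed

lemma tent_core_maps: "y \<in> {lo..hi} \<Longrightarrow> T y \<in> {lo..hi}"
proof -
  assume y: "y \<in> {lo..hi}"
  show ?thesis
  proof (cases "y \<le> crit")
    case True
    have "1 * y \<le> s * y" using s_gt lo_hi y by (intro mult_right_mono) auto
    moreover have "s * y \<le> s * crit" using True s_pos by simp
    moreover have "s * crit = hi" unfolding hi_eq by (simp add: crit_def)
    ultimately show ?thesis using True y unfolding tent_left[OF s_pos True] by simp
  next
    case False
    have "s * (1 - hi) \<le> s * (1 - y)" "s * (1 - y) \<le> s * (1 - crit)"
      using False y s_pos by auto
    moreover have "s * (1 - crit) = hi" "s * (1 - hi) = lo" unfolding hi_eq lo_eq by (simp_all add: crit_def)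
    moreover have "T y = s * (1 - y)" using False s_pos by (simp add: tent_right)
    ultimately show ?thesis by simp
  qed
qed

lemma tent_unit_maps: "y \<in> {0..1} \<Longrightarrow> T y \<in> {0..1}"
proof -
  assume y: "y \<in> {0..1}"
  have "T y \<le> 1"
  proof (cases "y \<le> crit")
    case True
    then have "s * y \<le> s * crit" using s_pos by simp
    also have "s * crit \<le> 1" using slope by (simp add: crit_def)
    finally show ?thesis using True s_pos by (simp add: tent_left)
  next
    case False
    then have "s * (1 - y) \<le> s * (1 - crit)" using s_pos by simp
    also have "s * (1 - crit) \<le> 1" using slope by (simp add: crit_def)
    finally show ?thesis using False s_pos by (simp add: tent_right)
  qed
  then show ?thesis using y s_pos by (auto simp: tent_def)
qed

lemma funpow_core: "y \<in> {lo..hi} \<Longrightarrow> (T ^^ n) y \<in> {lo..hi}"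
  by (induction n) (auto dest: tent_core_maps simp del: atLeastAtMost_iff)

lemma funpow_unit: "y \<in> {0..1} \<Longrightarrow> (T ^^ n) y \<in> {0..1}"
  by (induction n) (auto dest: tent_unit_maps simp del: atLeastAtMost_iff)

lemma core_unit: "y \<in> {lo..hi} \<Longrightarrow> y \<in> {0..1}"
  using lo_hi by auto

lemma crit_not_periodic: "\<not> periodic_pt T crit"
  using crit_preperiodic by (simp add: preperiodic_pt_def)

lemma orbit_ne_crit: "1 \<le> n \<Longrightarrow> (T ^^ n) crit \<noteq> crit"
  using crit_not_periodic unfolding periodic_pt_def by (metis less_le_trans zero_less_one)

lemma orbit_tent_ne_crit: "(T ^^ i) hi \<noteq> crit" "(T ^^ i) lo \<noteq> crit"
  using orbit_ne_crit[of "Suc i"] orbit_ne_crit[of "i + 2"]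
  by (simp_all add: funpow_swap1 numeral_2_eq_2)

text \<open>Iterates of periodic points are periodic, so non-periodicity passes from T^3(c) back to
  T^2(c) and T(c).\<close>

lemma not_periodic: "\<not> periodic_pt T hi" "\<not> periodic_pt T lo"
  using T3_not_periodic periodic_pt_funpow[of T hi 2] periodic_pt_funpow[of T lo 1]
  by (auto simp: numeral_2_eq_2 numeral_3_eq_3)

lemma follows_knead:
  "follows s (map (knead s) [0..<n]) hi"
  "follows s (map (knead s) [1..<Suc n]) lo"
proof -
  have "(T ^^ k) crit \<in> {0..1}" for k by (rule funpow_unit) (auto simp: crit_def)
  then have K: "(T ^^ k) crit \<in> (if (T ^^ k) crit > crit then {crit..1} else {0..crit})" for k by auto
  have "(T ^^ i) hi = (T ^^ Suc i) crit" "(T ^^ i) lo = (T ^^ Suc (Suc i)) crit" for i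
    by (simp_all add: funpow_swap1 numeral_2_eq_2)
  with K show "follows s (map (knead s) [0..<n]) hi" "follows s (map (knead s) [1..<Suc n]) lo"
    by (simp_all add: follows_iff nth_map_upt knead_def del: upt_Suc funpow.simps)
qed

text \<open>Every iterate of \<open>y\<close> lies between \<open>lo\<close> and \<open>hi\<close>,
  whose itineraries are the two bounds in the definition of admissibility. Strict order of points
  gives order of words; at an end point itself its unique itinerary is used instead.\<close>

lemma adm_word_follows:
  assumes y: "y \<in> {lo..hi}" and w: "follows s w y"
  shows "adm_word s w"
  unfolding adm_word_def
proof (intro allI impI conjI)
  fix i assume i: "i < length w"
  let ?z = "(T ^^ i) y" and ?n = "length w - i"
  have z: "?z \<in> {lo..hi}" using funpow_core y by blast
  have f: "follows s (drop i w) ?z" using w by (rule follows_drop)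
  show "plex_le (map (knead s) [1..<Suc ?n]) (drop i w)"
  proof (cases "?z = lo")
    case True
    then show ?thesis
      using follows_unique[OF orbit_tent_ne_crit(2), of "map (knead s) [1..<Suc ?n]" "drop i w"]
        follows_knead(2)[of ?n] f by (simp add: plex_le_def del: upt_Suc)
  next
    case False
    then show ?thesis
      using plex_le_of_less[OF s_pos _ _ follows_knead(2) f, of ?n] z i by (simp del: upt_Suc)
  qed
  show "plex_le (drop i w) (map (knead s) [0..<?n])"
  proof (cases "?z = hi")
    case True
    then show ?thesis
      using follows_unique[OF orbit_tent_ne_crit(1), of "map (knead s) [0..<?n]" "drop i w"]
        follows_knead(1)[of ?n] f by (simp add: plex_le_def)
  next
    case False
    then show ?thesis
      using plex_le_of_less[OF s_pos _ _ f follows_knead(1), of ?n] z i by simp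
  qed
qed

section \<open>Itineraries in the inverse limit\<close>

lemma coreD: "x \<in> tent_core s \<Longrightarrow> x i \<in> {lo..hi}" "x \<in> tent_core s \<Longrightarrow> T (x (Suc i)) = x i"
  by (auto simp: tent_core_def inv_lim_def)

lemma core_in_lim: "x \<in> tent_core s \<Longrightarrow> x \<in> tent_lim s"
  using core_unit by (fastforce simp: tent_core_def tent_lim_def inv_lim_def)

lemma funpow_core_point: "x \<in> tent_core s \<Longrightarrow> (T ^^ n) (x (i + n)) = x i"
  by (induction n) (simp_all add: funpow_swap1 coreD(2))

lemma coord_core: "x \<in> tent_core s \<Longrightarrow> coord s x i \<in> {lo..hi}"
  unfolding coord_def using coreD(1) funpow_core by metis

lemma coord_Suc:
  assumes "x \<in> tent_core s"
  shows "coord s x (i + 1) = T (coord s x i)"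
proof (cases "i \<ge> 0")
  case True
  then show ?thesis by (auto simp: coord_def nat_add_distrib)
next
  case False
  then have "nat (- i) = Suc (nat (- (i + 1)))" by simp
  then show ?thesis using False coreD(2)[OF assms] by (simp add: coord_def)
qed

lemma follows_subword:
  assumes x: "x \<in> tent_core s" and e: "\<And>i. coord s x i \<in> (if e i then {crit..1} else {0..crit})"
  shows "follows s (subword e i j) (coord s x i)"
proof (induction "nat (j + 1 - i)" arbitrary: i)
  case (Suc n)
  then have "[i..j] = i # [i+1..j]" by (simp add: upto_rec1)
  moreover have "follows s (subword e (i + 1) j) (coord s x (i + 1))" using Suc by simp
  ultimately show ?case using e[of i] coord_Suc[OF x, of i] by (simp add: subword_def)
qed (simp add: subword_def)

text \<open>In the core admissibility is automatic, because all coordinates stay in the core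
  interval.\<close>

lemma itinerary_iff:
  assumes "x \<in> tent_core s"
  shows "itinerary s x e \<longleftrightarrow> (\<forall>i. coord s x i \<in> (if e i then {crit..1} else {0..crit}))"
proof -
  have "e \<in> Sigma_adm s" if "\<forall>i. coord s x i \<in> (if e i then {crit..1} else {0..crit})"
    using adm_word_follows[OF coord_core follows_subword] assms that by (auto simp: Sigma_adm_def)
  then show ?thesis by (auto simp: itinerary_def)
qed

lemma left_compat_iff: "left_compat (left_part e) x \<longleftrightarrow>
    (\<forall>i<0. coord s x i \<in> (if e i then {crit..1} else {0..crit}))"
proof -
  have c: "coord s x (- int j - 1) = x (Suc j)" for j
    by (simp add: coord_def nat_add_distrib)
  have i: "- int (nat (- i - 1)) - 1 = i" if "i < 0" for i :: int using that by simp
  show ?thesis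
    unfolding left_compat_def left_part_def
  proof safe
    fix i :: int assume "\<forall>j. x (Suc j) \<in> (if e (- int j - 1) then {crit..1} else {0..crit})" "i < 0"
    then show "coord s x i \<in> (if e i then {crit..1} else {0..crit})"
      using c[of "nat (- i - 1)"] i[of i] by metis
  next
    fix j assume "\<forall>i<0. coord s x i \<in> (if e i then {crit..1} else {0..crit})"
    then have "coord s x (- int j - 1) \<in> (if e (- int j - 1) then {crit..1} else {0..crit})" by auto
    then show "x (Suc j) \<in> (if e (- int j - 1) then {crit..1} else {0..crit})" by (simp only: c)
  qed
qed

lemma basic_arc_iff:
  assumes x: "x \<in> tent_core s"
  shows "x \<in> basic_arc s v \<longleftrightarrow> left_compat v x"
proof
  assume "x \<in> basic_arc s v"
  then obtain e where "itinerary s x e" "left_part e = v" by (auto simp: basic_arc_def)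
  then show "left_compat v x"
    using itinerary_iff[OF x] left_compat_iff[of e x] by simp
next
  assume v: "left_compat v x"
  \<comment> \<open>A compatible left sequence is continued by the symbols of the forward orbit; at
    \<open>crit\<close> this chooses 0, one of the two allowed symbols.\<close>
  define e where "e i = (if i < 0 then v (nat (- i - 1)) else coord s x i > crit)" for i
  have l: "left_part e = v" by (auto simp: left_part_def e_def)
  have "coord s x i \<in> (if e i then {crit..1} else {0..crit})" for i
  proof (cases "i < 0")
    case True
    then show ?thesis using v left_compat_iff[of e x] by (simp add: l)
  next
    case False
    then show ?thesis using core_unit[OF coord_core[OF x, of i]] by (simp add: e_def)
  qed
  then have "itinerary s x e" using itinerary_iff[OF x] by blast
  then show "x \<in> basic_arc s v"
    unfolding basic_arc_def using core_in_lim[OF x] l by blast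
qed

lemma follows_left:
  assumes x: "x \<in> tent_core s" and v: "left_compat v x"
  shows "follows s (rev (map v [m..<n])) (x n)"
proof (cases "m \<le> n")
  case True
  then show ?thesis
  proof (induction n rule: dec_induct)
    case (step n)
    then show ?case using v coreD(2)[OF x, of n] by (simp add: left_compat_def)
  qed simp
qed simp

lemma adm_left_core_compat:
  assumes "x \<in> tent_core s" "left_compat v x"
  shows "adm_left_core s v"
  unfolding adm_left_core_def
proof (intro allI)
  fix m n
  show "adm_word s (rev (map v [m..<n]))"
    by (rule adm_word_follows[OF coreD(1)[OF assms(1)] follows_left[OF assms]])
qed

section \<open>Pulling back intervals\<close>

lemma tent_branch: "y \<in> {0..hi} \<Longrightarrow> T (branch s d y) = y"
  and branch_side: "y \<in> {0..hi} \<Longrightarrow> branch s d y \<in> (if d then {crit..1} else {0..crit})"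
  using s_pos by (auto simp: branch_def tent_def hi_eq crit_def min_def field_simps)

lemma branch_tent: "t \<in> (if d then {crit..1} else {0..crit}) \<Longrightarrow> branch s d (T t) = t"
  using s_pos by (cases d) (auto simp: branch_def tent_left tent_right)

text \<open>Since \<open>T hi = lo\<close>, the right inverse branch maps the open core interval
  onto the part of it right of \<open>crit\<close>. Hence a backward orbit continued by ones stays
  in the interior.\<close>

lemma branch_True: "y \<in> {lo<..<hi} \<Longrightarrow> branch s True y \<in> {lo<..<hi}"
proof -
  assume "y \<in> {lo<..<hi}"
  then have "0 < y" "y < s / 2" using lo_hi hi_eq by auto
  moreover from this have "0 < y / s" "y / s < 1 / 2" using s_pos by (auto simp: field_simps)
  ultimately have "1 / 2 < branch s True y" "branch s True y < 1" by (auto simp: branch_def)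
  moreover have "branch s True y < hi"
  proof -
    have "lo / s < y / s" using \<open>y \<in> {lo<..<hi}\<close> s_pos by (simp add: divide_strict_right_mono)
    then show ?thesis using s_pos by (simp add: branch_def lo_eq hi_eq)
  qed
  ultimately show ?thesis using lo_hi by (auto simp: crit_def)
qed

lemma postcritI: "lo \<in> postcrit" "hi \<in> postcrit" "y \<in> postcrit \<Longrightarrow> T y \<in> postcrit"
proof -
  show "hi \<in> postcrit" unfolding postcrit_def by (force intro: exI[of _ 1])
  show "lo \<in> postcrit" unfolding postcrit_def by (force intro: exI[of _ 2])
  assume "y \<in> postcrit"
  then obtain n where "y = (T ^^ n) crit" by (auto simp: postcrit_def)
  then have "T y = (T ^^ Suc n) crit" by simp
  then show "T y \<in> postcrit" unfolding postcrit_def by (force intro: exI[of _ "Suc n"])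
qed

lemma finite_postcrit: "finite postcrit"
proof -
  obtain m N where N: "N > 0" "(T ^^ N) ((T ^^ m) crit) = (T ^^ m) crit"
    using crit_preperiodic by (auto simp: preperiodic_pt_def periodic_pt_def)
  have "\<exists>k<m + N. (T ^^ n) crit = (T ^^ k) crit" for n
  proof (induction n rule: less_induct)
    case (less n)
    show ?case
    proof (cases "n < m + N")
      case False
      then have "n = n - N - m + (N + m)" "n - N = n - N - m + m" by auto
      then have "(T ^^ n) crit = (T ^^ (n - N)) crit"
        by (metis N(2) funpow_tent_nested)
      then show ?thesis using less[of "n - N"] N False by auto
    qed auto
  qed
  then have "postcrit \<subseteq> (\<lambda>k. (T ^^ k) crit) ` {..<m + N}" by (force simp: postcrit_def)
  then show ?thesis using finite_surj by blast
qed

lemma connected_avoiding_ends: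
  assumes "connected S" "z \<in> S" "z \<in> {lo<..<hi}" "lo \<notin> S" "hi \<notin> S"
  shows "S \<subseteq> {lo<..<hi}"
proof
  fix y assume y: "y \<in> S"
  show "y \<in> {lo<..<hi}"
  proof (rule ccontr)
    assume "y \<notin> {lo<..<hi}"
    then have "y \<le> lo \<or> hi \<le> y" by auto
    then show False
      using connectedD_interval[OF assms(1) y assms(2), of lo]
        connectedD_interval[OF assms(1,2) y, of hi] assms(3-) by auto
  qed
qed

text \<open>The pulled-back interval is connected, so it could leave the open core interval only
  through \<open>lo\<close> or \<open>hi\<close>. These are postcritical, and mapping forward would
  yield a postcritical point of \<open>J\<close>, that is \<open>t0\<close>, whose backward orbit is
  interior by assumption.\<close>

lemma pullback_interval:
  assumes J: "connected J" "t0 \<in> J" "J \<inter> postcrit \<subseteq> {t0}"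
    and core: "\<And>i. pullback s v t0 i \<in> {lo<..<hi}"
    and t: "t \<in> J"
  shows "pullback s v t i \<in> {lo<..<hi}" "pullback s v t i \<in> postcrit \<Longrightarrow> t = t0"
proof -
  have into: "(\<lambda>t. pullback s v t i) ` J \<subseteq> {lo<..<hi}"
    if "\<forall>t\<in>J. pullback s v t i \<in> postcrit \<longrightarrow> t = t0" for i
  proof (rule connected_avoiding_ends)
    show "connected ((\<lambda>t. pullback s v t i) ` J)"
      by (intro connected_continuous_image continuous_on_pullback J)
    show "pullback s v t0 i \<in> (\<lambda>t. pullback s v t i) ` J" using J by blast
    show "lo \<notin> (\<lambda>t. pullback s v t i) ` J" "hi \<notin> (\<lambda>t. pullback s v t i) ` J"
      using that postcritI core[of i] by auto
  qed (rule core)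
  have post: "\<forall>t\<in>J. pullback s v t i \<in> postcrit \<longrightarrow> t = t0" for i
  proof (induction i)
    case 0
    then show ?case using J by auto
  next
    case (Suc i)
    show ?case
    proof (intro ballI impI)
      fix t assume t: "t \<in> J" "pullback s v t (Suc i) \<in> postcrit"
      have "pullback s v t i \<in> {lo<..<hi}" using into[OF Suc] t by blast
      then have "T (pullback s v t (Suc i)) = pullback s v t i"
        using lo_hi by (simp add: tent_branch)
      then show "t = t0" using Suc t postcritI(3) by metis
    qed
  qed
  show "pullback s v t i \<in> {lo<..<hi}" using into[OF post] t by blast
  show "pullback s v t i \<in> postcrit \<Longrightarrow> t = t0" using post t by blast
qed

lemma pullback_core:
  assumes "\<And>i. pullback s v t i \<in> {lo..hi}"
  shows "pullback s v t \<in> tent_core s" "left_compat v (pullback s v t)"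
proof -
  have *: "pullback s v t i \<in> {0..hi}" for i using assms[of i] lo_hi by auto
  show "pullback s v t \<in> tent_core s"
    using assms tent_branch[OF *] by (simp add: tent_core_def inv_lim_def)
  show "left_compat v (pullback s v t)"
    using branch_side[OF *] by (simp add: left_compat_def del: atLeastAtMost_iff)
qed

lemma pullback_eq:
  assumes "x \<in> tent_core s" "left_compat v x"
  shows "pullback s v (x 0) i = x i"
proof (induction i)
  case (Suc i)
  then show ?case
    using assms(2) branch_tent[of "x (Suc i)" "v i"] coreD(2)[OF assms(1), of i]
    by (simp add: left_compat_def)
qed simp

text \<open>The new sequence follows \<open>v\<close> below \<open>m\<close>, takes \<open>d\<close>
  at \<open>m\<close> and is 1 after it, where \<open>i = m \<longrightarrow> d\<close> holds
  vacuously. Only the switch needs checking, as ones preserve the interior.\<close>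

lemma pullback_switch:
  assumes v: "\<And>i. i \<le> m \<Longrightarrow> pullback s v t i \<in> {lo<..<hi}"
    and d: "branch s d (pullback s v t m) \<in> {lo<..<hi}"
  shows "pullback s (\<lambda>i. if i < m then v i else i = m \<longrightarrow> d) t i \<in> {lo<..<hi}"
proof (induction i)
  case 0
  then show ?case using v[of 0] by simp
next
  case (Suc i)
  let ?w = "\<lambda>i. if i < m then v i else i = m \<longrightarrow> d"
  have same: "pullback s ?w t j = pullback s v t j" if "j \<le> m" for j
    using that by (intro pullback_cong) auto
  consider "i < m" | "i = m" | "m < i" by linarith
  then show ?case
  proof cases
    case 1
    then show ?thesis using same[of "Suc i"] v[of "Suc i"] by (simp only: Suc_le_eq)
  next
    case 2
    then have "pullback s ?w t (Suc i) = branch s d (pullback s v t m)" using same[of m] by simp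
    then show ?thesis using d by (simp only:)
  next
    case 3
    then have "pullback s ?w t (Suc i) = branch s True (pullback s ?w t i)" by simp
    then show ?thesis using branch_True[OF Suc] by (simp only:)
  qed
qed

end

section \<open>Blocking by horizontal segments\<close>

text \<open>Near the point the arc stays in the strip of half-width \<open>r\<close>. The segment at
  height \<open>h0\<close> forces it to change height, and by connectedness it then crosses one of
  the segments accumulating from above or below.\<close>

lemma not_accessible_between_segments:
  fixes K :: "(real \<times> real) set"
  assumes r: "0 < r"
    and mid: "\<And>t. \<bar>t - x0\<bar> < r \<Longrightarrow> (t, h0) \<in> K"
    and above: "\<And>h1. h0 < h1 \<Longrightarrow> \<exists>h. h0 < h \<and> h < h1 \<and> (\<forall>t. \<bar>t - x0\<bar> < r \<longrightarrow> (t, h) \<in> K)"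
    and below: "\<And>h1. h1 < h0 \<Longrightarrow> \<exists>h. h1 < h \<and> h < h0 \<and> (\<forall>t. \<bar>t - x0\<bar> < r \<longrightarrow> (t, h) \<in> K)"
  shows "\<not> accessible K (x0, h0)"
proof
  assume "accessible K (x0, h0)"
  then obtain g where g: "arc g" "path_image g \<inter> K = {(x0, h0)}"
    by (auto simp: accessible_def)
  then obtain t0 where t0: "t0 \<in> {0..1}" "g t0 = (x0, h0)"
    unfolding path_image_def by (metis Int_iff imageE insertI1)
  have cont: "continuous_on {0..1} g" and inj: "inj_on g {0..1}"
    using g by (auto simp: arc_def path_def)
  obtain \<eta> where \<eta>: "\<eta> > 0" "\<And>t. t \<in> {0..1} \<Longrightarrow> dist t t0 < \<eta> \<Longrightarrow> dist (g t) (g t0) < r"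
    using cont t0(1) r unfolding continuous_on_iff by meson
  \<comment> \<open>The point may be an end of the arc, so the second parameter is taken on a side
    where there is room.\<close>
  obtain t1 where t1: "t1 \<in> {0..1}" "t1 \<noteq> t0" "dist t1 t0 < \<eta>"
  proof (cases "t0 < 1")
    case True
    show ?thesis
      by (rule that[of "min 1 (t0 + \<eta> / 2)"]) (use True t0 \<eta> in \<open>auto simp: dist_real_def min_def\<close>)
  next
    case False
    show ?thesis
      by (rule that[of "max 0 (t0 - \<eta> / 2)"]) (use False t0 \<eta> in \<open>auto simp: dist_real_def max_def\<close>)
  qed
  define S where "S = closed_segment t0 t1"
  have S: "S \<subseteq> {0..1}" "\<And>t. t \<in> S \<Longrightarrow> dist t t0 < \<eta>" "t0 \<in> S" "t1 \<in> S"
    using t0 t1 by (auto simp: S_def closed_segment_eq_real_ivl dist_real_def split: if_splits)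
  have box: "\<bar>fst (g t) - x0\<bar> < r" if "t \<in> S" for t
    using \<eta>(2)[of t] S that t0(2) dist_fst_le[of "g t" "g t0"] by (auto simp: dist_real_def)
  have off: "g t \<notin> K" if "t \<in> S" "t \<noteq> t0" for t
  proof
    assume "g t \<in> K"
    then have "g t = g t0" using g(2) S(1) that(1) t0(2) by (auto simp: path_image_def)
    then show False using inj S(1) that t0(1) by (auto dest: inj_onD)
  qed
  have conn: "connected ((\<lambda>t. snd (g t)) ` S)"
    unfolding S_def
    by (intro connected_continuous_image continuous_intros continuous_on_subset[OF cont])
       (use S in \<open>auto simp: S_def\<close>)
  have hit: False if h: "\<forall>t. \<bar>t - x0\<bar> < r \<longrightarrow> (t, h) \<in> K" "h \<noteq> h0" "h \<in> (\<lambda>t. snd (g t)) ` S" for h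
  proof -
    obtain t where t: "t \<in> S" "h = snd (g t)" using h by auto
    then have "g t \<in> K" using h(1) box[OF t(1)] by (metis prod.collapse)
    then show False using off t t0 h(2) by (metis snd_conv)
  qed
  have ends: "h0 \<in> (\<lambda>t. snd (g t)) ` S" "snd (g t1) \<in> (\<lambda>t. snd (g t)) ` S"
    using S(3,4) t0(2) by force+
  have "snd (g t1) \<noteq> h0"
    using mid[OF box[OF S(4)]] off[OF S(4) t1(2)] by (metis prod.collapse)
  then consider "h0 < snd (g t1)" | "snd (g t1) < h0" by linarith
  then show False
  proof cases
    case 1
    then obtain h where "h0 < h" "h < snd (g t1)" "\<forall>t. \<bar>t - x0\<bar> < r \<longrightarrow> (t, h) \<in> K"
      using above by blast
    then show False using hit[of h] connectedD_interval[OF conn ends, of h] by simp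
  next
    case 2
    then obtain h where "snd (g t1) < h" "h < h0" "\<forall>t. \<bar>t - x0\<bar> < r \<longrightarrow> (t, h) \<in> K"
      using below by blast
    then show False using hit[of h] connectedD_interval[OF conn ends(2,1), of h] by simp
  qed
qed

context preperiodic_tent
begin

section \<open>Points whose coordinates are postcritical and periodic\<close>

definition post_periodic :: "(nat \<Rightarrow> real) \<Rightarrow> bool" where
  "post_periodic p \<longleftrightarrow> p \<in> tent_core s \<and> (\<forall>i. p i \<in> postcrit \<and> periodic_pt T (p i))"

definition left_code :: "(nat \<Rightarrow> real) \<Rightarrow> nat \<Rightarrow> bool" where
  "left_code p i \<longleftrightarrow> p (Suc i) > crit"

context
  fixes p :: "nat \<Rightarrow> real"
  assumes p: "post_periodic p"
begin

lemma p_core: "p \<in> tent_core s"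
  using p by (simp add: post_periodic_def)

text \<open>Every \<open>p i\<close> is periodic, whereas c, T(c), T^2(c) and T^3(c) are
  not.\<close>

lemma p_ne: "p i \<noteq> crit" "p i \<noteq> lo" "p i \<noteq> hi" "p i \<noteq> T lo"
proof -
  have "periodic_pt T (p i)" using p by (simp add: post_periodic_def)
  then show "p i \<noteq> crit" "p i \<noteq> lo" "p i \<noteq> hi" "p i \<noteq> T lo"
    using crit_not_periodic not_periodic T3_not_periodic
    by (auto simp: numeral_2_eq_2 numeral_3_eq_3)
qed

lemma p_inner: "p i \<in> {lo<..<hi}"
  using coreD(1)[OF p_core, of i] p_ne[of i] by auto

lemma coord_p_ne: "coord s p i \<noteq> crit"
proof (cases "i \<le> 0")
  case True
  then show ?thesis using p_ne by (simp add: coord_def)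
next
  case False
  have "periodic_pt T (p 0)" using p by (simp add: post_periodic_def)
  then show ?thesis using False periodic_pt_funpow crit_not_periodic by (metis coord_def)
qed

lemma left_compat_code: "left_compat v p \<longleftrightarrow> v = left_code p"
proof
  assume "left_compat v p"
  then show "v = left_code p"
    using p_ne(1) unfolding left_compat_def left_code_def
    by (intro ext) (metis atLeastAtMost_iff linorder_not_less order_antisym)
next
  assume "v = left_code p"
  then show "left_compat v p"
    using core_unit[OF coreD(1)[OF p_core]] by (auto simp: left_compat_def left_code_def)
qed

lemma itinerary_p: "itinerary s p e \<longleftrightarrow> e = (\<lambda>i. coord s p i > crit)"
proof
  assume "itinerary s p e"
  then show "e = (\<lambda>i. coord s p i > crit)"
    using coord_p_ne unfolding itinerary_iff[OF p_core]
    by (intro ext) (metis atLeastAtMost_iff linorder_not_less order_antisym)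
next
  assume "e = (\<lambda>i. coord s p i > crit)"
  then show "itinerary s p e"
    using core_unit[OF coord_core[OF p_core]] by (auto simp: itinerary_iff[OF p_core])
qed

lemma left_itinerary_p: "left_itinerary s p = left_code p"
  by (auto simp: left_itinerary_def itinerary_p left_part_def left_code_def coord_def nat_add_distrib)

lemma phi_p: "phi s L p = {(p 0, psi L (left_code p))}"
proof -
  have "e k = e' k" if "itinerary s p e" "itinerary s p e'" for e e' and k :: int
    using that by (simp add: itinerary_p)
  then show ?thesis
    unfolding phi_def glued_def basic_arc_iff[OF p_core] left_compat_code by blast
qed

lemma pullback_p: "pullback s (left_code p) (p 0) i = p i"
  by (rule pullback_eq[OF p_core]) (simp add: left_compat_code)

subsection \<open>Accessibility from a gap\<close>

text \<open>If the heights of the ends enclose that of \<open>p\<close>, all three left sequences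
  end in the same initial word of the kneading sequence. The parity of its ones is both the
  orientation of the affine map from index \<open>-j\<close> to 0 and the side of the semicircle;
  \<open>p j < hi\<close> then puts \<open>p 0\<close> on the other side.\<close>

lemma semicircle_misses_vertical:
  assumes x: "x \<in> tent_core s" "itinerary s x e" "itinerary s x e'" "glued s k e e'" "k < 0"
    and between: "min (psi L (left_part e)) (psi L (left_part e')) \<le> psi L (left_code p)"
      "psi L (left_code p) \<le> max (psi L (left_part e)) (psi L (left_part e'))"
    and q: "q \<in> semicircle (odd (ones (subword e (k + 1) (-1)))) (x 0) y z"
  shows "fst q \<noteq> p 0"
proof
  assume q0: "fst q = p 0"
  let ?u = "left_code p" and ?v = "left_part e" and ?v' = "left_part e'"
  define j where "j = nat (- k) - 1"
  have k: "k = - int j - 1" using x(5) by (simp add: j_def)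
  have vv': "?v i = ?v' i" if "i \<noteq> j" for i
    using x(4) that by (auto simp: glued_def left_part_def k)
  \<comment> \<open>Otherwise both ends differ in height from \<open>?u\<close> by at least
    \<open>1 / 3 ^ j\<close>, although they enclose it and are at most \<open>1 / 3 ^ j\<close>
    apart.\<close>
  have u: "?u i = ?v i" if "i < j" for i
  proof (rule ccontr)
    assume "?u i \<noteq> ?v i"
    moreover have "?u i \<noteq> ?v' i" using vv'[of i] that calculation by simp
    ultimately have "1 / 3 ^ j \<le> \<bar>psi L ?v - psi L ?u\<bar>" "1 / 3 ^ j \<le> \<bar>psi L ?v' - psi L ?u\<bar>"
      using psi_diff_ge[of i j ?u ?v L] psi_diff_ge[of i j ?u ?v' L] that
      by simp_all
    moreover have "\<bar>psi L ?v' - psi L ?v\<bar> \<le> 1 / 3 ^ j" using vv' by (intro psi_diff_le) auto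
    moreover have "0 < (1 / 3 ^ j :: real)" by simp
    ultimately show False using between by linarith
  qed
  define w where "w = subword e (k + 1) (-1)"
  have w_u: "w = rev (map ?u [0..<j])"
    using u rev_left_part[of e j] by (auto simp: w_def k simp flip: rev_left_part)
  have w_knead: "w = map (knead s) [0..<j]"
    using x(4) by (auto simp: w_def subword_def glued_def k intro!: nth_equalityI)
  have len: "length w = j" by (simp add: w_u)
  \<comment> \<open>Both symbols are allowed for this coordinate, which leaves only
    \<open>crit\<close>.\<close>
  have "x (Suc j) = crit"
  proof -
    have "coord s x k \<in> (if e k then {crit..1} else {0..crit})"
      "coord s x k \<in> (if e' k then {crit..1} else {0..crit})"
      using x(2,3) by (auto simp: itinerary_def simp del: atLeastAtMost_iff)
    then have "coord s x k = crit" using x(4) by (auto simp: glued_def split: if_splits)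
    then show ?thesis by (simp add: coord_def k nat_add_distrib)
  qed
  then have x0: "x 0 = (T ^^ j) hi"
    using funpow_core_point[OF x(1), of "Suc j" 0] by (simp add: funpow_swap1)
  have "follows s w (p j)" unfolding w_u
    by (rule follows_left[OF p_core]) (simp add: left_compat_code)
  moreover have "follows s w hi" unfolding w_knead by (rule follows_knead)
  ultimately have d: "x 0 - p 0 = (-1) ^ ones w * s ^ j * (hi - p j)"
    using follows_diff[OF s_pos, of w "p j" hi] funpow_core_point[OF p_core, of j 0]
    by (simp add: x0 len)
  have "0 < s ^ j * (hi - p j)" using p_inner[of j] s_pos by simp
  then have "if odd (ones w) then x 0 < p 0 else p 0 < x 0"
    using d by (auto simp: minus_one_power_iff)
  then show False using q q0 by (auto simp: semicircle_def w_def split: if_splits)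
qed

lemma semicircle_between:
  assumes "q \<in> semicircle b a y z"
  shows "min y z \<le> snd q" "snd q \<le> max y z"
proof -
  have "dist (a, (y + z) / 2) q = \<bar>y - z\<bar> / 2" using assms by (auto simp: semicircle_def)
  then have "\<bar>(y + z) / 2 - snd q\<bar> \<le> \<bar>y - z\<bar> / 2"
    using dist_snd_le[of "(a, (y + z) / 2)" q] by (simp add: dist_real_def)
  then show "min y z \<le> snd q" "snd q \<le> max y z"
    by (auto simp: min_def max_def abs_if field_simps split: if_splits)
qed

text \<open>\<open>\<sigma>\<close> tells whether the gap is above (1) or below (-1). The arc is a
  vertical segment reaching half-way into the gap.\<close>

lemma accessible_of_gap:
  assumes \<delta>: "0 < \<delta>" and \<sigma>: "\<sigma> \<in> {1, -1}"
    and gap: "\<And>x v. x \<in> tent_core s \<Longrightarrow> left_compat v x \<Longrightarrow>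
      \<not> (0 < \<sigma> * (psi L v - psi L (left_code p)) \<and> \<sigma> * (psi L v - psi L (left_code p)) < \<delta>)"
  shows "accessible (drawing s L) (p 0, psi L (left_code p))"
proof -
  let ?h = "psi L (left_code p)"
  have miss: "(p 0, ?h + \<sigma> * \<tau>) \<notin> drawing s L" if \<tau>: "0 < \<tau>" "\<tau> < \<delta>" for \<tau>
  proof
    assume "(p 0, ?h + \<sigma> * \<tau>) \<in> drawing s L"
    then obtain x where x: "x \<in> tent_core s" "(p 0, ?h + \<sigma> * \<tau>) \<in> phi s L x"
      by (auto simp: drawing_def)
    then consider (flat) v where "x \<in> basic_arc s v" "?h + \<sigma> * \<tau> = psi L v"
      | (semi) e e' k where "k < 0" "glued s k e e'" "itinerary s x e" "itinerary s x e'"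
        "(p 0, ?h + \<sigma> * \<tau>) \<in> semicircle (odd (ones (subword e (k + 1) (-1)))) (x 0)
            (psi L (left_part e)) (psi L (left_part e'))"
      unfolding phi_def by blast
    then show False
    proof cases
      case flat
      then show False using gap[OF x(1), of v] \<sigma> \<tau> basic_arc_iff[OF x(1)] by auto
    next
      case semi
      have compat: "left_compat (left_part e) x" "left_compat (left_part e') x"
        using semi(3,4) itinerary_iff[OF x(1)] left_compat_iff by auto
      \<comment> \<open>Neither end of the semicircle lies in the gap, but one of its points does,
        so the ends enclose the gap and the height of \<open>p\<close>.\<close>
      have "min (psi L (left_part e)) (psi L (left_part e')) \<le> ?h"
        "?h \<le> max (psi L (left_part e)) (psi L (left_part e'))"
        using gap[OF x(1) compat(1)] gap[OF x(1) compat(2)] semicircle_between[OF semi(5)] \<sigma> \<tau>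
        by (auto simp: min_def max_def split: if_splits)
      then show False using semicircle_misses_vertical[OF x(1) semi(3,4,2,1) _ _ semi(5)] by simp
    qed
  qed
  let ?g = "linepath (p 0, ?h) (p 0, ?h + \<sigma> * (\<delta> / 2))"
  have "arc ?g" using \<sigma> \<delta> by (intro arc_linepath) auto
  moreover have "path_image ?g \<inter> drawing s L = {(p 0, ?h)}"
  proof -
    have in_K: "(p 0, ?h) \<in> drawing s L"
      using p_core phi_p[of L] unfolding drawing_def by blast
    have "q = (p 0, ?h)" if q: "q \<in> path_image ?g" "q \<in> drawing s L" for q
    proof -
      obtain r where r: "0 \<le> r" "r \<le> 1" "q = (1 - r) *\<^sub>R (p 0, ?h) + r *\<^sub>R (p 0, ?h + \<sigma> * (\<delta> / 2))"
        using q(1) by (auto simp: in_segment)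
      then have eq: "q = (p 0, ?h + \<sigma> * (r * \<delta> / 2))" by (simp add: algebra_simps)
      have "r = 0"
      proof (rule ccontr)
        assume "r \<noteq> 0"
        then have "0 < r * \<delta> / 2" "r * \<delta> / 2 < \<delta>" using r \<delta> mult_right_mono[of r 1 \<delta>] by auto
        then show False using miss[of "r * \<delta> / 2"] q(2) eq by simp
      qed
      then show ?thesis using eq by simp
    qed
    then show ?thesis using in_K by auto
  qed
  ultimately show ?thesis unfolding accessible_def by blast
qed

subsection \<open>Full arcs accumulating at an element that is not extremal\<close>

text \<open>Only the left branch could fail. If its value \<open>z\<close> were below
  \<open>lo\<close>, its word would be at most the kneading bound, and by admissibility also at
  least that bound. Then \<open>z\<close> and \<open>lo\<close> share \<open>Suc k\<close> symbols,
  and their distance is stretched beyond 1 when \<open>k\<close> is large.\<close>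

lemma turn_point_inner:
  "\<exists>N. \<forall>k\<ge>N. \<forall>v. adm_left_core s v \<longrightarrow> (\<forall>i<k. v i = left_code p i) \<longrightarrow> v k \<noteq> left_code p k \<longrightarrow>
     branch s (v k) (p k) \<in> {lo<..<hi}"
proof -
  \<comment> \<open>\<open>d\<close> bounds the distance of \<open>T lo\<close> from all other
    postcritical points, hence from every \<open>p k\<close>; \<open>N\<close> is such that
    \<open>s ^ N\<close> stretches \<open>d\<close> beyond 1.\<close>
  obtain d where d: "d > 0" "\<And>x. x \<in> postcrit \<Longrightarrow> x \<noteq> T lo \<Longrightarrow> d \<le> dist (T lo) x"
    using finite_set_avoid[OF finite_postcrit, of "T lo"] by auto
  obtain N where N: "1 / d < s ^ N" using real_arch_pow[OF s_gt(2)] by blast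
  show ?thesis
  proof (intro exI[of _ N] allI impI)
    fix k v
    assume k: "N \<le> k" and v: "adm_left_core s v" "\<forall>i<k. v i = left_code p i" "v k \<noteq> left_code p k"
    show "branch s (v k) (p k) \<in> {lo<..<hi}"
    proof (cases "v k")
      case True
      then show ?thesis using branch_True[OF p_inner] by simp
    next
      case False
      define z where "z = branch s False (p k)"
      have pk: "p k \<in> {0..hi}" using p_inner[of k] lo_hi by auto
      have z: "T z = p k" "z \<in> {0..crit}" "z < hi"
        using tent_branch[OF pk, of False] branch_side[OF pk, of False] lo_hi by (auto simp: z_def)
      have "lo < z"
      proof (rule ccontr)
        assume "\<not> lo < z"
        moreover have "z \<noteq> lo" using z(1) p_ne(4)[of k] by auto
        ultimately have "z < lo" by simp
        let ?w = "rev (map v [0..<Suc k])"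
        have w: "?w = False # rev (map (left_code p) [0..<k])"
          using v(2) False by simp
        have len: "length ?w = Suc k" by simp
        have fol: "follows s ?w z"
          unfolding w using z follows_left[OF p_core, of "left_code p" 0 k] by (simp add: left_compat_code)
        have "plex_le ?w (map (knead s) [1..<Suc (Suc k)])"
          by (rule plex_le_of_less[OF s_pos _ \<open>z < lo\<close> fol follows_knead(2)]) simp
        moreover have "plex_le (map (knead s) [1..<Suc (Suc k)]) ?w"
        proof -
          have "adm_word s ?w" using v(1) by (simp add: adm_left_core_def del: upt_Suc)
          then show ?thesis unfolding adm_word_def using len by (metis drop0 minus_nat.diff_0 zero_less_Suc)
        qed
        ultimately have "?w = map (knead s) [1..<Suc (Suc k)]"
          by (intro plex_le_antisym) (simp_all del: upt_Suc)
        then have fol': "follows s ?w lo" using follows_knead(2)[of "Suc k"] by simp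
        have "(T ^^ Suc k) lo - (T ^^ Suc k) z = (-1) ^ ones ?w * s ^ Suc k * (lo - z)"
          using follows_diff[OF s_pos fol fol'] by (simp only: len)
        then have "\<bar>(T ^^ Suc k) lo - (T ^^ Suc k) z\<bar> = s ^ k * (s * (lo - z))"
          using \<open>z < lo\<close> s_pos by (simp add: abs_mult power_abs)
        also have "s * (lo - z) = T lo - p k"
          using z lo_hi s_pos tent_left[of s z] tent_left[of s lo] by (simp add: algebra_simps)
        finally have "s ^ k * (T lo - p k) \<le> 1"
          using funpow_unit[of z "Suc k"] funpow_unit[of lo "Suc k"] z(2) lo_hi by (auto simp: crit_def)
        moreover have "d \<le> T lo - p k"
        proof -
          have "p k < T lo" using \<open>s * (lo - z) = T lo - p k\<close> \<open>z < lo\<close> s_pos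
            by (metis diff_gt_0_iff_gt mult_pos_pos)
          then show ?thesis using d(2)[of "p k"] p by (auto simp: post_periodic_def dist_real_def)
        qed
        moreover have "1 < s ^ k * d"
        proof -
          have "s ^ N \<le> s ^ k" using s_gt k by (intro power_increasing) auto
          then have "1 / d < s ^ k" using N by simp
          then show ?thesis using d(1) by (simp add: field_simps)
        qed
        moreover have "0 \<le> s ^ k" using s_pos by simp
        ultimately show False using mult_left_mono[of d "T lo - p k" "s ^ k"] by linarith
      qed
      then show ?thesis using z False by (simp add: z_def)
    qed
  qed
qed

lemma full_arc:
  "\<exists>N. \<forall>n\<ge>N. \<forall>v. adm_left_core s v \<longrightarrow> v \<noteq> left_code p \<longrightarrow> (\<forall>i<n. v i = left_code p i) \<longrightarrow>
     (\<exists>v'. (\<forall>i<n. v' i = left_code p i) \<and> v' \<noteq> left_code p \<and>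
        (psi L (left_code p) < psi L v \<longleftrightarrow> psi L (left_code p) < psi L v') \<and>
        (\<forall>i. pullback s v' (p 0) i \<in> {lo<..<hi}))"
proof -
  let ?u = "left_code p"
  obtain N where N: "\<And>k v. N \<le> k \<Longrightarrow> adm_left_core s v \<Longrightarrow> (\<And>i. i < k \<Longrightarrow> v i = ?u i) \<Longrightarrow>
      v k \<noteq> ?u k \<Longrightarrow> branch s (v k) (p k) \<in> {lo<..<hi}"
    using turn_point_inner by metis
  show ?thesis
  proof (intro exI[of _ N] allI impI)
    fix n v
    assume n: "N \<le> n" and v: "adm_left_core s v" "v \<noteq> ?u" "\<forall>i<n. v i = ?u i"
    obtain k where k: "\<And>j. j < k \<Longrightarrow> ?u j = v j" "?u k \<noteq> v k"
      using first_difference[of ?u v] v(2) by metis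
    have nk: "n \<le> k" using k(2) v(3) by (metis not_le)
    \<comment> \<open>Up to and including the first departure from \<open>?u\<close> nothing
      changes, which preserves the side; ones follow.\<close>
    define v' where "v' i = (if i < k then ?u i else i = k \<longrightarrow> v k)" for i
    have "branch s (v k) (p k) \<in> {lo<..<hi}" using N[of k v] nk n v(1) k by simp
    then have "pullback s v' (p 0) i \<in> {lo<..<hi}" for i
      unfolding v'_def by (rule pullback_switch[of k ?u "p 0" "v k", unfolded pullback_p, OF p_inner])
    moreover have "psi L ?u < psi L v \<longleftrightarrow> psi L ?u < psi L v'"
      by (rule psi_less_cong[of k]) (use k in \<open>auto simp: v'_def le_less\<close>)
    moreover have "v' k \<noteq> ?u k" using k(2) by (simp add: v'_def)
    then have "v' \<noteq> ?u" by blast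
    moreover have "\<forall>i<n. v' i = ?u i" using nk v(3) by (auto simp: v'_def)
    ultimately show "\<exists>v'. (\<forall>i<n. v' i = ?u i) \<and> v' \<noteq> ?u \<and>
        (psi L ?u < psi L v \<longleftrightarrow> psi L ?u < psi L v') \<and>
        (\<forall>i. pullback s v' (p 0) i \<in> {lo<..<hi})" by blast
  qed
qed

text \<open>An interval around \<open>p 0\<close> free of other postcritical points pulls back
  inside the core along each such \<open>v\<close>, so one \<open>r\<close> serves all of
  them.\<close>

lemma full_arcs_in_drawing:
  obtains r where "0 < r"
    "\<And>v t. (\<And>i. pullback s v (p 0) i \<in> {lo<..<hi}) \<Longrightarrow> \<bar>t - p 0\<bar> < r \<Longrightarrow> (t, psi L v) \<in> drawing s L"
proof -
  obtain d where d: "d > 0" "\<And>x. x \<in> postcrit \<Longrightarrow> x \<noteq> p 0 \<Longrightarrow> d \<le> dist (p 0) x"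
    using finite_set_avoid[OF finite_postcrit, of "p 0"] by auto
  have "(t, psi L v) \<in> drawing s L"
    if v: "\<And>i. pullback s v (p 0) i \<in> {lo<..<hi}" and t: "\<bar>t - p 0\<bar> < d" for v t
  proof -
    let ?x = "pullback s v t"
    have "?x i \<in> {lo<..<hi}" for i
    proof (rule pullback_interval(1)[OF _ _ _ v])
      show "ball (p 0) d \<inter> postcrit \<subseteq> {p 0}" using d(2) by fastforce
    qed (use t d in \<open>auto simp: dist_real_def\<close>)
    then have "?x i \<in> {lo..hi}" for i by (meson greaterThanLessThan_subseteq_atLeastAtMost_iff order.refl subsetD)
    then have x: "?x \<in> tent_core s" "left_compat v ?x" by (rule pullback_core)+
    then have "(?x 0, psi L v) \<in> phi s L ?x" by (auto simp: phi_def basic_arc_iff)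
    then show ?thesis using x(1) by (auto simp: drawing_def)
  qed
  then show thesis using that d(1) by blast
qed

lemma extremal_iff_accessible:
  "(\<exists>a. phi s L p = {a} \<and> accessible (drawing s L) a) \<longleftrightarrow>
     (\<exists>w. w \<noteq> [] \<and> adm_word s w \<and>
        (is_top L (cylinder s w) (left_itinerary s p) \<or>
         is_bottom L (cylinder s w) (left_itinerary s p)))"
proof -
  let ?u = "left_code p"
  have "accessible (drawing s L) (p 0, psi L ?u) \<longleftrightarrow>
     (\<exists>w. w \<noteq> [] \<and> adm_word s w \<and> (is_top L (cylinder s w) ?u \<or> is_bottom L (cylinder s w) ?u))"
    (is "?A \<longleftrightarrow> ?E")
  proof
    assume ?E
    then obtain w where w: "is_top L (cylinder s w) ?u \<or> is_bottom L (cylinder s w) ?u" by blast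
    \<comment> \<open>A top has its gap above and a bottom has it below.\<close>
    define \<sigma> :: real where "\<sigma> = (if is_top L (cylinder s w) ?u then 1 else -1)"
    have uw: "rev (map ?u [0..<length w]) = w"
      using w by (auto simp: is_top_def is_bottom_def cylinder_def)
    have ext: "\<sigma> * (psi L v - psi L ?u) \<le> 0" if "v \<in> cylinder s w" for v
      using w that by (auto simp: is_top_def is_bottom_def \<sigma>_def left_less_iff)
    show ?A
    \<comment> \<open>A sequence outside the cylinder differs from \<open>?u\<close> among the first
      \<open>length w\<close> indices, so its height is at least this far away.\<close>
    proof (rule accessible_of_gap[of "1 / 3 ^ length w" \<sigma>])
      fix x v assume "x \<in> tent_core s" "left_compat v x"
      then have adm: "adm_left_core s v" by (rule adm_left_core_compat)
      show "\<not> (0 < \<sigma> * (psi L v - psi L ?u) \<and> \<sigma> * (psi L v - psi L ?u) < 1 / 3 ^ length w)"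
      proof (cases "\<forall>i<length w. v i = ?u i")
        case True
        then have "rev (map v [0..<length w]) = w"
          using rev_map_upt_eq_iff[of v "length w" ?u] uw by simp
        then show ?thesis using ext[of v] adm by (auto simp: cylinder_def)
      next
        case False
        then obtain i where "i < length w" "?u i \<noteq> v i" by auto
        then have "1 / 3 ^ length w \<le> \<bar>psi L v - psi L ?u\<bar>"
          using psi_diff_ge[of i "length w" ?u v L] by simp
        then show ?thesis by (auto simp: \<sigma>_def)
      qed
    qed (auto simp: \<sigma>_def)
  next
    assume acc: ?A
    show ?E
    proof (rule ccontr)
      assume nE: "\<not> ?E"
      obtain N where N: "\<And>n v. N \<le> n \<Longrightarrow> adm_left_core s v \<Longrightarrow> v \<noteq> ?u \<Longrightarrow> (\<forall>i<n. v i = ?u i) \<Longrightarrow>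
          \<exists>v'. (\<forall>i<n. v' i = ?u i) \<and> v' \<noteq> ?u \<and> (psi L ?u < psi L v \<longleftrightarrow> psi L ?u < psi L v') \<and>
            (\<forall>i. pullback s v' (p 0) i \<in> {lo<..<hi})"
        using full_arc[of L] by metis
      have adm_u: "adm_left_core s ?u"
        by (rule adm_left_core_compat[OF p_core]) (simp add: left_compat_code)
      have close: "\<exists>v'. v' \<noteq> ?u \<and> \<bar>psi L v' - psi L ?u\<bar> < \<epsilon> \<and> (psi L ?u < psi L v' \<longleftrightarrow> up) \<and>
          (\<forall>i. pullback s v' (p 0) i \<in> {lo<..<hi})" if \<epsilon>: "0 < \<epsilon>" for \<epsilon> up
      proof -
        obtain m where m: "(1 / 3) ^ m < \<epsilon>" using real_arch_pow_inv[OF \<epsilon>, of "1 / 3"] by auto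
        \<comment> \<open>\<open>N\<close> makes the full arc available, 1 keeps the word nonempty,
          and \<open>m\<close> brings the heights within \<open>\<epsilon>\<close>.\<close>
        define n where "n = max (max N 1) m"
        let ?w = "rev (map ?u [0..<n])"
        have "?w \<noteq> []" by (simp add: n_def)
        moreover have "adm_word s ?w" using adm_u by (simp add: adm_left_core_def)
        ultimately have not_ext: "\<not> is_top L (cylinder s ?w) ?u" "\<not> is_bottom L (cylinder s ?w) ?u"
          using nE by blast+
        have mem: "v \<in> cylinder s ?w \<longleftrightarrow> adm_left_core s v \<and> (\<forall>i<n. v i = ?u i)" for v
          using rev_map_upt_eq_iff[of v n ?u] by (simp add: cylinder_def)
        have "\<exists>v\<in>cylinder s ?w. v \<noteq> ?u \<and> (psi L ?u < psi L v \<longleftrightarrow> up)"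
          using not_ext adm_u psi_inj[of L ?u] unfolding is_top_def is_bottom_def left_less_iff
          by (cases up) (metis mem linorder_neqE, metis mem linorder_neqE order.asym)
        then obtain v where v: "adm_left_core s v" "v \<noteq> ?u" "\<forall>i<n. v i = ?u i" "psi L ?u < psi L v \<longleftrightarrow> up"
          using mem by auto
        then obtain v' where v': "\<forall>i<n. v' i = ?u i" "v' \<noteq> ?u" "psi L ?u < psi L v' \<longleftrightarrow> up"
          "\<forall>i. pullback s v' (p 0) i \<in> {lo<..<hi}"
          using N[OF _ v(1-3)] v(4) by (metis max.cobounded1 max.coboundedI1 n_def)
        have "\<bar>psi L v' - psi L ?u\<bar> \<le> 1 / 3 ^ n" using v'(1) by (intro psi_diff_le) simp
        also have "\<dots> \<le> 1 / 3 ^ m" by (intro divide_left_mono power_increasing) (auto simp: n_def)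
        finally have "\<bar>psi L v' - psi L ?u\<bar> < \<epsilon>" using m by (simp add: power_divide)
        then show ?thesis using v' by blast
      qed
      obtain r where r: "0 < r" "\<And>v t. (\<And>i. pullback s v (p 0) i \<in> {lo<..<hi}) \<Longrightarrow> \<bar>t - p 0\<bar> < r \<Longrightarrow>
          (t, psi L v) \<in> drawing s L"
        using full_arcs_in_drawing[of L] by metis
      have "\<not> accessible (drawing s L) (p 0, psi L ?u)"
      proof (rule not_accessible_between_segments[OF r(1)])
        fix t assume "\<bar>t - p 0\<bar> < r"
        then show "(t, psi L ?u) \<in> drawing s L"
          using r(2)[of ?u t] p_inner by (simp add: pullback_p)
      next
        fix h1 assume "psi L ?u < h1"
        then obtain v' where "\<bar>psi L v' - psi L ?u\<bar> < h1 - psi L ?u" "psi L ?u < psi L v'"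
          "\<forall>i. pullback s v' (p 0) i \<in> {lo<..<hi}" using close[of "h1 - psi L ?u" True] by auto
        then show "\<exists>h. psi L ?u < h \<and> h < h1 \<and> (\<forall>t. \<bar>t - p 0\<bar> < r \<longrightarrow> (t, h) \<in> drawing s L)"
          using r(2)[of v'] by (intro exI[of _ "psi L v'"]) auto
      next
        fix h1 assume "h1 < psi L ?u"
        then obtain v' where v': "\<bar>psi L v' - psi L ?u\<bar> < psi L ?u - h1" "\<not> psi L ?u < psi L v'" "v' \<noteq> ?u"
          "\<forall>i. pullback s v' (p 0) i \<in> {lo<..<hi}" using close[of "psi L ?u - h1" False] by auto
        then have "psi L v' < psi L ?u" using psi_inj[of L v' ?u] by linarith
        then show "\<exists>h. h1 < h \<and> h < psi L ?u \<and> (\<forall>t. \<bar>t - p 0\<bar> < r \<longrightarrow> (t, h) \<in> drawing s L)"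
          using r(2)[of v'] v' by (intro exI[of _ "psi L v'"]) auto
      qed
      then show False using acc by simp
    qed
  qed
  then show ?thesis by (simp add: phi_p left_itinerary_p)
qed

end

section \<open>Folding points\<close>

lemma core_shift: "x \<in> tent_core s \<Longrightarrow> (\<lambda>i. x (k + i)) \<in> tent_core s"
  by (simp add: tent_core_def inv_lim_def)

text \<open>\<open>postcrit\<close> is forward invariant, so no coordinate further back is
  postcritical, and in particular none is an end point of the core interval.\<close>

lemma coord_inner:
  assumes "x \<in> tent_core s" "x 0 \<notin> postcrit"
  shows "x i \<in> {lo<..<hi}"
proof -
  have "x i \<notin> postcrit"
  proof (induction i)
    case (Suc i)
    then show ?case using postcritI(3) coreD(2)[OF assms(1), of i] by metis
  qed (use assms in simp)
  then show ?thesis using coreD(1)[OF assms(1), of i] postcritI(1,2) by (cases "x i = lo"; cases "x i = hi") auto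
qed

lemma coord_ne_crit:
  assumes "x \<in> tent_core s" "x 0 \<notin> postcrit"
  shows "x (Suc i) \<noteq> crit"
  using coord_inner[OF assms, of i] coreD(2)[OF assms(1), of i] by auto

lemma left_compat_left_code: "x \<in> tent_core s \<Longrightarrow> left_compat (left_code x) x"
  using core_unit[OF coreD(1)] by (auto simp: left_compat_def left_code_def)

lemma continuous_on_tent_funpow: "continuous_on A (T ^^ n)"
proof (induction n)
  case (Suc n)
  have "continuous_on UNIV T"
    unfolding tent_def[abs_def] by (intro continuous_intros)
  then show ?case
    using continuous_on_compose2[of UNIV T A "T ^^ n"] Suc by (simp add: comp_def)
qed (simp add: id_def)

lemma continuous_on_pullback_joint:
  "continuous_on A (\<lambda>z. pullback s (snd z) (fst z) i)"
proof (induction i)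
  case 0
  then show ?case by (simp add: continuous_intros)
next
  case (Suc i)
  \<comment> \<open>With the symbol read as the number 0 or 1 the choice of branch becomes a
    polynomial expression, continuous in both arguments.\<close>
  let ?d = "\<lambda>z :: real \<times> (nat \<Rightarrow> bool). of_bool (snd z i) :: real"
  have "continuous_on A ?d"
  proof (rule continuous_on_compose2[of UNIV of_bool])
    show "continuous_on A (\<lambda>z. snd z i)"
      by (rule continuous_on_product_then_coordinatewise[OF continuous_on_snd[OF continuous_on_id]])
  qed auto
  moreover have "pullback s (snd z) (fst z) (Suc i) =
      ?d z * (1 - pullback s (snd z) (fst z) i * (1 / s)) +
      (1 - ?d z) * (pullback s (snd z) (fst z) i * (1 / s))" for z
    by (simp add: branch_def)
  ultimately show ?case using Suc by (simp only:) (intro continuous_intros)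
qed

section \<open>The set of backward itineraries over a point\<close>

definition branch_set :: "real \<Rightarrow> (nat \<Rightarrow> bool) set" where
  "branch_set t = {b. \<forall>i. pullback s b t i \<in> {lo..hi}}"

lemma branch_set_inner:
  assumes "t \<notin> postcrit" "b \<in> branch_set t"
  shows "pullback s b t i \<in> {lo<..<hi}"
proof (rule coord_inner)
  show "pullback s b t \<in> tent_core s"
    using assms(2) by (intro pullback_core) (simp add: branch_set_def)
qed (use assms in simp)

lemma closed_branch_set: "closed (branch_set t)"
proof -
  have "continuous_on UNIV (\<lambda>b. pullback s b t i)" for i
    using continuous_on_compose2[OF continuous_on_pullback_joint[of UNIV i], of UNIV "\<lambda>b. (t, b)"]
    by (simp add: continuous_intros)
  then have "closed ((\<lambda>b. pullback s b t i) -` {lo..hi})" for i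
    by (intro closed_vimage) auto
  moreover have "branch_set t = (\<Inter>i. (\<lambda>b. pullback s b t i) -` {lo..hi})"
    by (auto simp: branch_set_def)
  ultimately show ?thesis by (simp add: closed_INT)
qed

text \<open>Equivalently, \<open>T lo\<close> lies to the left of the fixed point of the right branch. This is
  where \<open>s > sqrt 2\<close> rather than just \<open>s > 1\<close> enters.\<close>

lemma T_lo_less: "T lo < 1 - lo"
proof -
  have "0 < (s - 1) * (s * s - 2)" using s_gt by simp
  moreover have "(s - 1) * (s * s - 2) = 2 * (1 - (1 + s) * lo)"
    unfolding lo_eq by (simp add: field_simps)
  ultimately have "(1 + s) * lo < 1" by simp
  moreover have "T lo = s * lo" using lo_hi s_pos by (intro tent_left) auto
  ultimately show ?thesis by (simp add: algebra_simps)
qed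

lemma branch_set_perfect:
  assumes t: "t \<notin> postcrit" and b: "b \<in> branch_set t"
  shows "\<exists>b'\<in>branch_set t. (\<forall>m<n. b' m = b m) \<and> b' \<noteq> b"
proof -
  let ?y = "\<lambda>i. pullback s b t i"
  have y: "?y i \<in> {lo<..<hi}" for i by (rule branch_set_inner[OF t b])
  obtain m where m: "n \<le> m" "branch s (\<not> b m) (?y m) \<in> {lo<..<hi}"
  proof -
    have right: "branch s (\<not> b m) (?y m) \<in> {lo<..<hi}" if "\<not> b m" for m
      using that branch_True[OF y[of m]] by simp
    have left: "branch s (\<not> b m) (?y m) \<in> {lo<..<hi}" if "b m" "T lo < ?y m" for m
    proof -
      have "branch s False (?y m) \<le> crit" using branch_side[of "?y m" False] y[of m] lo_hi by auto
      moreover have "lo < branch s False (?y m)"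
        using that(2) tent_left[OF s_pos, of lo] lo_hi s_pos by (simp add: branch_def field_simps)
      ultimately show ?thesis using that(1) lo_hi by simp
    qed
    \<comment> \<open>The right branch is always possible, the left one when
      \<open>T lo < ?y m\<close>. If \<open>b n\<close> and \<open>b (Suc n)\<close> are 1 and
      \<open>?y n\<close> is too small, then \<open>?y (Suc n) = 1 - ?y n / s\<close> is at least
      \<open>1 - lo\<close>, which is large enough.\<close>
    consider "\<not> b n" | "\<not> b (Suc n)" | "b n" "T lo < ?y n" | "b (Suc n)" "b n" "?y n \<le> T lo" by linarith
    then show thesis
    proof cases
      case 4
      have "?y n / s \<le> lo"
        using 4(3) tent_left[OF s_pos, of lo] lo_hi s_pos by (simp add: field_simps)
      then have "T lo < ?y (Suc n)" using T_lo_less 4(2) by (simp add: branch_def)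
      then show thesis using that[of "Suc n"] left[OF 4(1)] by simp
    next
      case 1
      then show thesis by (rule that[OF order.refl right])
    next
      case 2
      then show thesis by (rule that[OF le_SucI[OF order.refl] right])
    next
      case 3
      then show thesis by (rule that[OF order.refl left])
    qed
  qed
  define b' where "b' i = (if i < m then b i else i = m \<longrightarrow> \<not> b m)" for i
  have "pullback s b' t i \<in> {lo<..<hi}" for i
    unfolding b'_def by (rule pullback_switch[OF y m(2)])
  then have "pullback s b' t i \<in> {lo..hi}" for i
    by (meson greaterThanLessThan_subseteq_atLeastAtMost_iff order.refl subsetD)
  then have "b' \<in> branch_set t" unfolding branch_set_def by blast
  moreover have "\<forall>j<n. b' j = b j" using m(1) by (simp add: b'_def)
  moreover have "b' m \<noteq> b m" by (simp add: b'_def)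
  then have "b' \<noteq> b" by blast
  ultimately show ?thesis by blast
qed

lemma left_code_in_branch_set:
  assumes "x \<in> tent_core s"
  shows "left_code x \<in> branch_set (x 0)"
  using pullback_eq[OF assms left_compat_left_code[OF assms]] coreD(1)[OF assms]
  by (simp add: branch_set_def del: atLeastAtMost_iff)

text \<open>An interval without postcritical points pulls back as a whole along each backward
  itinerary of one of its points.\<close>

lemma branch_set_transfer:
  assumes J: "connected J" "J \<inter> postcrit = {}" "t \<in> J" "t' \<in> J"
  shows "branch_set t \<subseteq> branch_set t'"
proof
  fix b assume b: "b \<in> branch_set t"
  have "t \<notin> postcrit" using J by blast
  then have "pullback s b t' i \<in> {lo<..<hi}" for i
    by (intro pullback_interval(1)[OF J(1,3) _ _ J(4)] branch_set_inner[OF _ b]) (use J(2) in auto)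
  then have "pullback s b t' i \<in> {lo..hi}" for i
    by (meson greaterThanLessThan_subseteq_atLeastAtMost_iff order.refl subsetD)
  then show "b \<in> branch_set t'" unfolding branch_set_def by blast
qed

text \<open>Coordinate \<open>k\<close> gives the coordinates of smaller number by iteration and,
  with the symbols beyond \<open>k\<close>, the remaining ones by inverse branches. No coordinate
  beyond \<open>k\<close> equals \<open>crit\<close>, so these symbols are unique and
  continuous.\<close>

lemma box_homeomorphic:
  assumes J: "connected J" "J \<inter> postcrit = {}" "t0 \<in> J"
  shows "{x \<in> tent_core s. x k \<in> J} homeomorphic (J \<times> branch_set t0)"
proof -
  let ?U = "{x \<in> tent_core s. x k \<in> J}"
  let ?sh = "\<lambda>x i. x (k + i)"
  let ?F = "\<lambda>x. (x k, left_code (?sh x))"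
  let ?G = "\<lambda>z i. if i \<le> k then (T ^^ (k - i)) (fst z) else pullback s (snd z) (fst z) (i - k)"
  have sh: "?sh x \<in> tent_core s" "?sh x 0 \<notin> postcrit" if "x \<in> ?U" for x
    using that core_shift J(2) by auto
  show ?thesis
    unfolding homeomorphic_minimal
  proof (intro exI conjI ballI)
    fix x assume x: "x \<in> ?U"
    have "left_code (?sh x) \<in> branch_set (x k)" using left_code_in_branch_set[OF sh(1)[OF x]] by simp
    then show "?F x \<in> J \<times> branch_set t0"
      using branch_set_transfer[OF J(1,2) _ J(3)] x by auto
    show "?G (?F x) = x"
    proof
      fix i
      show "?G (?F x) i = x i"
      proof (cases "i \<le> k")
        case True
        then show ?thesis using funpow_core_point[of x "k - i" i] x by simp
      next
        case False
        then show ?thesis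
          using pullback_eq[OF sh(1)[OF x] left_compat_left_code[OF sh(1)[OF x]], of "i - k"] by simp
      qed
    qed
  next
    fix z assume z: "z \<in> J \<times> branch_set t0"
    obtain t b where tb: "z = (t, b)" "t \<in> J" "b \<in> branch_set t0" using z by auto
    then have b: "b \<in> branch_set t" using branch_set_transfer[OF J(1,2,3)] by blast
    have t: "t \<notin> postcrit" using tb(2) J(2) by blast
    have pb: "pullback s b t \<in> tent_core s" "left_compat b (pullback s b t)"
      using b by (auto intro!: pullback_core simp: branch_set_def)
    have Gk: "?G z (k + i) = pullback s b t i" for i
      by (cases i) (simp_all add: tb)
    have "?G z i \<in> {lo..hi}" for i
    proof (cases "i \<le> k")
      case True
      then show ?thesis using funpow_core[OF coreD(1)[OF pb(1), of 0]] tb by simp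
    next
      case False
      then show ?thesis using coreD(1)[OF pb(1), of "i - k"] tb by simp
    qed
    moreover have "T (?G z (Suc i)) = ?G z i" for i
    proof (cases "i < k")
      case True
      then have "T (?G z (Suc i)) = (T ^^ Suc (k - Suc i)) t" by (simp add: tb)
      also have "\<dots> = ?G z i" using True by (simp only: Suc_diff_Suc) (simp add: tb)
      finally show ?thesis .
    next
      case False
      then obtain m where i: "i = k + m" by (metis le_Suc_ex not_less)
      have "T (?G z (k + Suc m)) = ?G z (k + m)" by (simp only: Gk coreD(2)[OF pb(1)])
      then show ?thesis by (simp only: i add_Suc_right)
    qed
    ultimately have G_core: "?G z \<in> tent_core s" unfolding tent_core_def inv_lim_def by blast
    then show "?G z \<in> ?U" using tb by simp
    have "left_code (?sh (?G z)) = left_code (pullback s b t)"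
      using Gk by (simp only: left_code_def[abs_def])
    also have "\<dots> = b"
    proof
      fix i
      show "left_code (pullback s b t) i = b i"
        using pb(2)[unfolded left_compat_def, rule_format, of i] coord_ne_crit[OF pb(1), of i] t
        unfolding left_code_def by (cases "b i") auto
    qed
    finally show "?F (?G z) = z" by (simp add: tb)
  next
    show "continuous_on ?U ?F"
    proof (intro continuous_on_Pair)
      have c: "continuous_on ?U (\<lambda>x. x i)" for i
        by (rule continuous_on_product_then_coordinatewise[OF continuous_on_id])
      then show "continuous_on ?U (\<lambda>x. x k)" .
      show "continuous_on ?U (\<lambda>x. left_code (?sh x))"
        unfolding left_code_def[abs_def]
      proof (intro continuous_on_coordinatewise_then_product continuous_on_greater_const c)
        fix i x assume x: "x \<in> ?U"
        show "x (k + Suc i) \<noteq> crit" by (rule coord_ne_crit[OF sh(1)[OF x] sh(2)[OF x]])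
      qed
    qed
    show "continuous_on (J \<times> branch_set t0) ?G"
    proof (rule continuous_on_coordinatewise_then_product)
      fix i
      have "continuous_on (J \<times> branch_set t0) (\<lambda>z. (T ^^ (k - i)) (fst z))"
        by (rule continuous_on_compose2[OF continuous_on_tent_funpow[of UNIV] continuous_on_fst[OF continuous_on_id]]) simp
      then show "continuous_on (J \<times> branch_set t0) (\<lambda>z. ?G z i)"
        using continuous_on_pullback_joint by (cases "i \<le> k") simp_all
    qed
  qed
qed

lemma folding_coords_postcrit:
  assumes "folding_point s p"
  shows "p k \<in> postcrit"
proof (rule ccontr)
  assume pk: "p k \<notin> postcrit"
  have p: "p \<in> tent_core s" using assms by (simp add: folding_point_def)
  obtain d where d: "d > 0" "\<And>x. x \<in> postcrit \<Longrightarrow> x \<noteq> p k \<Longrightarrow> d \<le> dist (p k) x"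
    using finite_set_avoid[OF finite_postcrit, of "p k"] by auto
  define J where "J = {p k - d<..<p k + d}"
  define U where "U = {x \<in> tent_core s. x k \<in> J}"
  have J: "connected J" "J \<inter> postcrit = {}" "p k \<in> J"
    using d pk by (force simp: J_def dist_real_def)+
  have "branch_set (p k) homeomorphic cantor_set"
  proof (rule perfect_homeomorphic_cantor[OF branch_set_perfect[OF pk] closed_branch_set])
    show "branch_set (p k) \<noteq> {}"
      using left_code_in_branch_set[OF core_shift[OF p, of k]] by auto
  qed
  then have "U homeomorphic (cantor_set \<times> {0<..<1::real})"
    using homeomorphic_trans[OF box_homeomorphic[OF J]]
      homeomorphic_Times_swap[OF homeomorphic_open_interval_unit[OF d(1)]]
    unfolding J_def U_def by blast
  moreover have "openin (top_of_set (tent_core s)) U"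
  proof -
    have "open ((\<lambda>x. x k) -` J)"
      by (auto intro!: open_vimage continuous_on_product_coordinates simp: J_def)
    moreover have "U = tent_core s \<inter> (\<lambda>x. x k) -` J" by (auto simp: U_def)
    ultimately show ?thesis by (metis openin_open_Int)
  qed
  moreover have "p \<in> U" "U \<subseteq> tent_core s" using p J(3) by (auto simp: U_def)
  ultimately show False using assms unfolding folding_point_def by blast
qed

lemma folding_post_periodic:
  assumes "folding_point s p"
  shows "post_periodic p"
proof -
  have p: "p \<in> tent_core s" using assms by (simp add: folding_point_def)
  have "periodic_pt T (p k)" for k
  proof -
    \<comment> \<open>Two equal coordinates among those from \<open>k\<close> on yield a periodic
      point, and \<open>p k\<close> is an iterate of it.\<close>
    have "finite (range (\<lambda>i. p (k + i)))"
      by (rule finite_subset[OF _ finite_postcrit]) (use folding_coords_postcrit[OF assms] in auto)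
    then have "\<not> inj (\<lambda>i. p (k + i))"
      using finite_imageD[of "\<lambda>i. p (k + i)" UNIV] by auto
    then obtain i j where "i < j" "p (k + i) = p (k + j)"
      unfolding inj_def by (metis linorder_neqE_nat)
    moreover have "(T ^^ (j - i)) (p (k + j)) = p (k + i)"
      using funpow_core_point[OF p, of "j - i" "k + i"] \<open>i < j\<close> by simp
    ultimately have "periodic_pt T (p (k + i))"
      unfolding periodic_pt_def by (metis zero_less_diff)
    then show ?thesis
      using periodic_pt_funpow[of T "p (k + i)" i] funpow_core_point[OF p, of i k] by simp
  qed
  then show ?thesis using p folding_coords_postcrit[OF assms] by (simp add: post_periodic_def)
qed

end

theorem proposition9p16:
  fixes s :: real and L :: "nat \<Rightarrow> bool" and p :: "nat \<Rightarrow> real"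
  assumes slope: "sqrt 2 < s" "s \<le> 2"
    and crit_preperiodic: "preperiodic_pt (tent s) crit"
    and T3_not_periodic: "\<not> periodic_pt (tent s) ((tent s ^^ 3) crit)"
    and L_admissible: "adm_left s L"
    and L_no_zero_tail: "\<And>n. \<exists>j\<ge>n. L j"
    and p_folding: "folding_point s p"
  shows "(\<exists>a. phi s L p = {a} \<and> accessible (drawing s L) a) \<longleftrightarrow>
         (\<exists>w. w \<noteq> [] \<and> adm_word s w \<and>
            (is_top L (cylinder s w) (left_itinerary s p) \<or>
             is_bottom L (cylinder s w) (left_itinerary s p)))"
proof -
  interpret preperiodic_tent s
    using slope crit_preperiodic T3_not_periodic by unfold_locales
  show ?thesis by (rule extremal_iff_accessible[OF folding_post_periodic[OF p_folding]])
qed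

end
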